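(* Let $G\in\mathcal V_3$ and let $D\leq G$ be a subgroup with $D\leq_{\mathrm{LCS}}G$. Then for every $B\in\mathcal V_3$, the natural homomorphism $D*_{\mathcal V_3}B\to G*_{\mathcal V_3}B$ induced by the inclusion $D\leq G$ is injective.
   Context: $\mathcal V_3$ is the variety of groups satisfying $x^3=1$. $G*_{\mathcal V_3}H=(G*H)/\langle\langle (G*H)^3\rangle\rangle$ is the coproduct of $G$ and $H$ in $\mathcal V_3$ (the quotient of the free product by the normal closure of all cubes). The lower central series of a group is $\gamma_1(G)=G$, $\gamma_{n+1}(G)=[\gamma_n(G),G]$. For $D\leq G$ in $\mathcal V_3$, $D\leq_{\mathrm{LCS}}G$ means $\gamma_2(D)=\gamma_2(G)\cap D$ and $\gamma_3(D)=\gamma_3(G)\cap D$. *)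

theory Defs
  imports "HOL-Algebra.Generated_Groups"
begin

definition free_product_words ::
  "('a, 'c) monoid_scheme \<Rightarrow> ('b, 'd) monoid_scheme \<Rightarrow> ('a + 'b) list set" where
  "free_product_words G H = lists (carrier G <+> carrier H)"

text \<open>The monoid congruence on words that multiplies adjacent letters from the same factor and
  deletes the letters that are identities.\<close>

inductive free_product_cong ::
  "('a, 'c) monoid_scheme \<Rightarrow> ('b, 'd) monoid_scheme \<Rightarrow> ('a + 'b) list \<Rightarrow> ('a + 'b) list \<Rightarrow> bool"
  for G H where
  refl: "u \<in> free_product_words G H \<Longrightarrow> free_product_cong G H u u"
| sym: "free_product_cong G H u v \<Longrightarrow> free_product_cong G H v u"
| trans: "\<lbrakk>free_product_cong G H u v; free_product_cong G H v w\<rbrakk> \<Longrightarrow> free_product_cong G H u w"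
| append: "\<lbrakk>free_product_cong G H u u'; free_product_cong G H v v'\<rbrakk>
    \<Longrightarrow> free_product_cong G H (u @ v) (u' @ v')"
| one_left: "free_product_cong G H [Inl \<one>\<^bsub>G\<^esub>] []"
| one_right: "free_product_cong G H [Inr \<one>\<^bsub>H\<^esub>] []"
| mult_left: "\<lbrakk>x \<in> carrier G; y \<in> carrier G\<rbrakk>
    \<Longrightarrow> free_product_cong G H [Inl x, Inl y] [Inl (x \<otimes>\<^bsub>G\<^esub> y)]"
| mult_right: "\<lbrakk>x \<in> carrier H; y \<in> carrier H\<rbrakk>
    \<Longrightarrow> free_product_cong G H [Inr x, Inr y] [Inr (x \<otimes>\<^bsub>H\<^esub> y)]"

definition free_product_class ::
  "('a, 'c) monoid_scheme \<Rightarrow> ('b, 'd) monoid_scheme \<Rightarrow> ('a + 'b) list \<Rightarrow> ('a + 'b) list set" where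
  "free_product_class G H w = {v. free_product_cong G H w v}"

definition free_product ::
  "('a, 'c) monoid_scheme \<Rightarrow> ('b, 'd) monoid_scheme \<Rightarrow> ('a + 'b) list set monoid" where
  "free_product G H =
    \<lparr>carrier = free_product_class G H ` free_product_words G H,
     monoid.mult = (\<lambda>X Y. \<Union>u\<in>X. \<Union>v\<in>Y. free_product_class G H (u @ v)),
     one = free_product_class G H []\<rparr>"

definition free_product_inl ::
  "('a, 'c) monoid_scheme \<Rightarrow> ('b, 'd) monoid_scheme \<Rightarrow> 'a \<Rightarrow> ('a + 'b) list set" where
  "free_product_inl G H x = free_product_class G H [Inl x]"

definition free_product_inr ::
  "('a, 'c) monoid_scheme \<Rightarrow> ('b, 'd) monoid_scheme \<Rightarrow> 'b \<Rightarrow> ('a + 'b) list set" where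
  "free_product_inr G H y = free_product_class G H [Inr y]"

text \<open>The map on words is letterwise, so only the codomain enters: the parameters \<open>G\<close> and \<open>H\<close> are the factors of
  the codomain.\<close>

definition free_product_map ::
  "('c, 'e) monoid_scheme \<Rightarrow> ('d, 'f) monoid_scheme \<Rightarrow> ('a \<Rightarrow> 'c) \<Rightarrow> ('b \<Rightarrow> 'd)
    \<Rightarrow> ('a + 'b) list set \<Rightarrow> ('c + 'd) list set" where
  "free_product_map G H f g X =
    the_elem ((\<lambda>w. free_product_class G H (map (map_sum f g) w)) ` X)"

lemma free_product_words_simps [simp]:
  "[] \<in> free_product_words G H"
  "u @ v \<in> free_product_words G H \<longleftrightarrow> u \<in> free_product_words G H \<and> v \<in> free_product_words G H"
  "Inl x # u \<in> free_product_words G H \<longleftrightarrow> x \<in> carrier G \<and> u \<in> free_product_words G H"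
  "Inr y # u \<in> free_product_words G H \<longleftrightarrow> y \<in> carrier H \<and> u \<in> free_product_words G H"
  by (auto simp: free_product_words_def)

lemma free_product_words_induct [consumes 1, case_names Nil Inl Inr]:
  assumes "w \<in> free_product_words G H"
    and "P []"
    and "\<And>x u. \<lbrakk>x \<in> carrier G; u \<in> free_product_words G H; P u\<rbrakk> \<Longrightarrow> P (Inl x # u)"
    and "\<And>y u. \<lbrakk>y \<in> carrier H; u \<in> free_product_words G H; P u\<rbrakk> \<Longrightarrow> P (Inr y # u)"
  shows "P w"
  using assms(1)
proof (induction w)
  case (Cons a w)
  then show ?case by (cases a) (auto intro: assms)
qed (rule assms)

lemma free_product_cong_words:
  assumes "group G" "group H" "free_product_cong G H u v"
  shows "u \<in> free_product_words G H \<and> v \<in> free_product_words G H"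
proof -
  interpret G: group G by fact
  interpret H: group H by fact
  show ?thesis
    using assms(3) by induction auto
qed

lemma free_product_class_eq_iff:
  assumes "v \<in> free_product_words G H"
  shows "free_product_class G H u = free_product_class G H v \<longleftrightarrow> free_product_cong G H u v"
proof
  assume "free_product_class G H u = free_product_class G H v"
  then show "free_product_cong G H u v"
    using free_product_cong.refl[OF assms] unfolding free_product_class_def by blast
next
  assume uv: "free_product_cong G H u v"
  have "free_product_cong G H u w \<longleftrightarrow> free_product_cong G H v w" for w
    by (rule iffI) (erule free_product_cong.trans[OF free_product_cong.sym[OF uv]]
      free_product_cong.trans[OF uv])+
  then show "free_product_class G H u = free_product_class G H v"
    unfolding free_product_class_def by (intro Collect_cong)
qed

lemma free_product_the_elem:
  assumes "w \<in> free_product_words G H" "\<And>v. free_product_cong G H w v \<Longrightarrow> f v = f w"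
  shows "the_elem (f ` free_product_class G H w) = f w"
proof (rule the_elem_image_unique)
  show "free_product_class G H w \<noteq> {}"
    using free_product_cong.refl[OF assms(1)] unfolding free_product_class_def by blast
  show "f v = f w" if "v \<in> free_product_class G H w" for v
    using that unfolding free_product_class_def by (intro assms(2)) simp
qed

lemma free_product_mult:
  assumes "u \<in> free_product_words G H" "v \<in> free_product_words G H"
  shows "free_product_class G H u \<otimes>\<^bsub>free_product G H\<^esub> free_product_class G H v
    = free_product_class G H (u @ v)"
proof -
  have "free_product_class G H (u' @ v') = free_product_class G H (u @ v)"
    if "u' \<in> free_product_class G H u" "v' \<in> free_product_class G H v" for u' v'
  proof -
    have "free_product_cong G H (u' @ v') (u @ v)"
      using that unfolding free_product_class_def
      by (intro free_product_cong.append free_product_cong.sym[of G H u]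
          free_product_cong.sym[of G H v]) simp_all
    then show ?thesis
      using assms by (simp add: free_product_class_eq_iff)
  qed
  moreover have "u \<in> free_product_class G H u" "v \<in> free_product_class G H v"
    using assms by (simp_all add: free_product_class_def free_product_cong.refl)
  ultimately have "(\<Union>u'\<in>free_product_class G H u. \<Union>v'\<in>free_product_class G H v.
      free_product_class G H (u' @ v')) = free_product_class G H (u @ v)"
    by blast
  then show ?thesis by (simp add: free_product_def)
qed

lemma free_product_group:
  assumes "group G" "group H"
  shows "group (free_product G H)"
proof -
  interpret G: group G by fact
  interpret H: group H by fact
  let ?c = "free_product_class G H" and ?W = "free_product_words G H"
  have inv: "\<exists>v\<in>?W. free_product_cong G H (v @ w) []" if "w \<in> ?W" for w
    using that
  proof (induction rule: free_product_words_induct)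
    case Nil
    show ?case by (rule bexI[of _ "[]"]) (auto intro: free_product_cong.refl)
  next
    case (Inl x u)
    then obtain v where v: "v \<in> ?W" "free_product_cong G H (v @ u) []" by blast
    have "free_product_cong G H [Inl (inv\<^bsub>G\<^esub> x), Inl x] [Inl \<one>\<^bsub>G\<^esub>]"
      using Inl free_product_cong.mult_left[of "inv\<^bsub>G\<^esub> x" G x H] by simp
    then have "free_product_cong G H [Inl (inv\<^bsub>G\<^esub> x), Inl x] []"
      by (rule free_product_cong.trans) (rule free_product_cong.one_left)
    then have "free_product_cong G H (v @ [Inl (inv\<^bsub>G\<^esub> x), Inl x] @ u) (v @ [] @ u)"
      using v Inl by (intro free_product_cong.append free_product_cong.refl)
    then have "free_product_cong G H (v @ [Inl (inv\<^bsub>G\<^esub> x), Inl x] @ u) []"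
      by (rule free_product_cong.trans) (simp add: v)
    then have "free_product_cong G H ((v @ [Inl (inv\<^bsub>G\<^esub> x)]) @ Inl x # u) []"
      by simp
    then show ?case
      using v Inl by (intro bexI[of _ "v @ [Inl (inv\<^bsub>G\<^esub> x)]"]) auto
  next
    case (Inr x u)
    then obtain v where v: "v \<in> ?W" "free_product_cong G H (v @ u) []" by blast
    have "free_product_cong G H [Inr (inv\<^bsub>H\<^esub> x), Inr x] [Inr \<one>\<^bsub>H\<^esub>]"
      using Inr free_product_cong.mult_right[of "inv\<^bsub>H\<^esub> x" H x G] by simp
    then have "free_product_cong G H [Inr (inv\<^bsub>H\<^esub> x), Inr x] []"
      by (rule free_product_cong.trans) (rule free_product_cong.one_right)
    then have "free_product_cong G H (v @ [Inr (inv\<^bsub>H\<^esub> x), Inr x] @ u) (v @ [] @ u)"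
      using v Inr by (intro free_product_cong.append free_product_cong.refl)
    then have "free_product_cong G H (v @ [Inr (inv\<^bsub>H\<^esub> x), Inr x] @ u) []"
      by (rule free_product_cong.trans) (simp add: v)
    then have "free_product_cong G H ((v @ [Inr (inv\<^bsub>H\<^esub> x)]) @ Inr x # u) []"
      by simp
    then show ?case
      using v Inr by (intro bexI[of _ "v @ [Inr (inv\<^bsub>H\<^esub> x)]"]) auto
  qed
  have car: "carrier (free_product G H) = ?c ` ?W" and one: "\<one>\<^bsub>free_product G H\<^esub> = ?c []"
    by (simp_all add: free_product_def)
  show ?thesis
  proof (rule groupI)
    fix X Y assume "X \<in> carrier (free_product G H)" "Y \<in> carrier (free_product G H)"
    then show "X \<otimes>\<^bsub>free_product G H\<^esub> Y \<in> carrier (free_product G H)"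
      by (auto simp: car free_product_mult)
  next
    show "\<one>\<^bsub>free_product G H\<^esub> \<in> carrier (free_product G H)"
      by (auto simp: car one)
  next
    fix X Y Z
    assume "X \<in> carrier (free_product G H)" "Y \<in> carrier (free_product G H)"
      "Z \<in> carrier (free_product G H)"
    then show "X \<otimes>\<^bsub>free_product G H\<^esub> Y \<otimes>\<^bsub>free_product G H\<^esub> Z
        = X \<otimes>\<^bsub>free_product G H\<^esub> (Y \<otimes>\<^bsub>free_product G H\<^esub> Z)"
      by (auto simp: car free_product_mult)
  next
    fix X assume "X \<in> carrier (free_product G H)"
    then show "\<one>\<^bsub>free_product G H\<^esub> \<otimes>\<^bsub>free_product G H\<^esub> X = X"
      by (auto simp: car one free_product_mult)
  next
    fix X assume "X \<in> carrier (free_product G H)"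
    then obtain w where w: "w \<in> ?W" "X = ?c w" by (auto simp: car)
    from inv[OF w(1)] obtain v where v: "v \<in> ?W" "free_product_cong G H (v @ w) []" by blast
    have "?c v \<otimes>\<^bsub>free_product G H\<^esub> X = \<one>\<^bsub>free_product G H\<^esub>"
      using v w by (simp add: free_product_mult one free_product_class_eq_iff)
    then show "\<exists>Y\<in>carrier (free_product G H). Y \<otimes>\<^bsub>free_product G H\<^esub> X = \<one>\<^bsub>free_product G H\<^esub>"
      using v by (auto simp: car)
  qed
qed

lemma free_product_inl_hom:
  assumes "group G" shows "free_product_inl G H \<in> hom G (free_product G H)"
proof -
  interpret G: group G by fact
  show ?thesis
  proof (rule homI)
    fix x assume "x \<in> carrier G"
    then show "free_product_inl G H x \<in> carrier (free_product G H)"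
      by (simp add: free_product_inl_def free_product_def)
  next
    fix x y assume "x \<in> carrier G" "y \<in> carrier G"
    then show "free_product_inl G H (x \<otimes>\<^bsub>G\<^esub> y)
        = free_product_inl G H x \<otimes>\<^bsub>free_product G H\<^esub> free_product_inl G H y"
      by (simp add: free_product_inl_def free_product_mult free_product_class_eq_iff
          free_product_cong.sym[OF free_product_cong.mult_left])
  qed
qed

lemma free_product_inr_hom:
  assumes "group H" shows "free_product_inr G H \<in> hom H (free_product G H)"
proof -
  interpret H: group H by fact
  show ?thesis
  proof (rule homI)
    fix x assume "x \<in> carrier H"
    then show "free_product_inr G H x \<in> carrier (free_product G H)"
      by (simp add: free_product_inr_def free_product_def)
  next
    fix x y assume "x \<in> carrier H" "y \<in> carrier H"
    then show "free_product_inr G H (x \<otimes>\<^bsub>H\<^esub> y)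
        = free_product_inr G H x \<otimes>\<^bsub>free_product G H\<^esub> free_product_inr G H y"
      by (simp add: free_product_inr_def free_product_mult free_product_class_eq_iff
          free_product_cong.sym[OF free_product_cong.mult_right])
  qed
qed

lemma free_product_induct [consumes 1, case_names one inl inr]:
  assumes "X \<in> carrier (free_product G H)"
    and "P \<one>\<^bsub>free_product G H\<^esub>"
    and "\<And>x Y. \<lbrakk>x \<in> carrier G; Y \<in> carrier (free_product G H); P Y\<rbrakk>
      \<Longrightarrow> P (free_product_inl G H x \<otimes>\<^bsub>free_product G H\<^esub> Y)"
    and "\<And>y Y. \<lbrakk>y \<in> carrier H; Y \<in> carrier (free_product G H); P Y\<rbrakk>
      \<Longrightarrow> P (free_product_inr G H y \<otimes>\<^bsub>free_product G H\<^esub> Y)"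
  shows "P X"
proof -
  obtain w where w: "w \<in> free_product_words G H" "X = free_product_class G H w"
    using assms(1) by (auto simp: free_product_def)
  have "P (free_product_class G H w)"
    using w(1)
  proof (induction rule: free_product_words_induct)
    case Nil
    then show ?case using assms(2) by (simp add: free_product_def)
  next
    case (Inl x u)
    have "free_product_class G H (Inl x # u)
        = free_product_inl G H x \<otimes>\<^bsub>free_product G H\<^esub> free_product_class G H u"
      using Inl by (simp add: free_product_inl_def free_product_mult)
    then show ?case
      using Inl assms(3)[of x "free_product_class G H u"] by (simp add: free_product_def)
  next
    case (Inr x u)
    have "free_product_class G H (Inr x # u)
        = free_product_inr G H x \<otimes>\<^bsub>free_product G H\<^esub> free_product_class G H u"
      using Inr by (simp add: free_product_inr_def free_product_mult)
    then show ?case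
      using Inr assms(4)[of x "free_product_class G H u"] by (simp add: free_product_def)
  qed
  with w(2) show ?thesis by simp
qed

lemma free_product_universal:
  assumes "group G" "group H" "group K" "f \<in> hom G K" "g \<in> hom H K"
  obtains h where "h \<in> hom (free_product G H) K"
    "\<And>x. x \<in> carrier G \<Longrightarrow> h (free_product_inl G H x) = f x"
    "\<And>y. y \<in> carrier H \<Longrightarrow> h (free_product_inr G H y) = g y"
proof -
  interpret G: group G by fact
  interpret H: group H by fact
  interpret K: group K by fact
  interpret f: group_hom G K f by unfold_locales fact
  interpret g: group_hom H K g by unfold_locales fact
  define e where "e w = foldr (\<lambda>a r. case_sum f g a \<otimes>\<^bsub>K\<^esub> r) w \<one>\<^bsub>K\<^esub>" for w
  have e_simps [simp]: "e [] = \<one>\<^bsub>K\<^esub>" "e (Inl x # w) = f x \<otimes>\<^bsub>K\<^esub> e w"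
    "e (Inr y # w) = g y \<otimes>\<^bsub>K\<^esub> e w" for x y w
    by (simp_all add: e_def)
  have e_closed [simp]: "e w \<in> carrier K" if "w \<in> free_product_words G H" for w
    using that by (induction rule: free_product_words_induct) simp_all
  have e_append: "e (u @ v) = e u \<otimes>\<^bsub>K\<^esub> e v"
    if "u \<in> free_product_words G H" "v \<in> free_product_words G H" for u v
    using that by (induction rule: free_product_words_induct) (simp_all add: K.m_assoc)
  have e_cong: "e u = e v" if "free_product_cong G H u v" for u v
    using that
  proof induction
    case (append u u' v v')
    then show ?case
      using free_product_cong_words[OF assms(1,2)] by (simp add: e_append)
  qed (simp_all)
  define h where "h X = the_elem (e ` X)" for X
  have h: "h (free_product_class G H w) = e w" if "w \<in> free_product_words G H" for w
    unfolding h_def using that by (rule free_product_the_elem) (metis e_cong)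
  show thesis
  proof
    show "h \<in> hom (free_product G H) K"
    proof (rule homI)
      fix X assume "X \<in> carrier (free_product G H)"
      then show "h X \<in> carrier K" by (auto simp: free_product_def h)
    next
      fix X Y assume XY: "X \<in> carrier (free_product G H)" "Y \<in> carrier (free_product G H)"
      obtain u v where "u \<in> free_product_words G H" "X = free_product_class G H u"
        "v \<in> free_product_words G H" "Y = free_product_class G H v"
        using XY by (auto simp: free_product_def)
      then show "h (X \<otimes>\<^bsub>free_product G H\<^esub> Y) = h X \<otimes>\<^bsub>K\<^esub> h Y"
        by (simp add: free_product_mult h e_append)
    qed
    show "h (free_product_inl G H x) = f x" if "x \<in> carrier G" for x
      using that by (simp add: free_product_inl_def h)
    show "h (free_product_inr G H y) = g y" if "y \<in> carrier H" for y
      using that by (simp add: free_product_inr_def h)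
  qed
qed

lemma free_product_map_class:
  assumes "group G" "group H" "group G'" "group H'" "f \<in> hom G G'" "g \<in> hom H H'"
    and w: "w \<in> free_product_words G H"
  shows "map (map_sum f g) w \<in> free_product_words G' H'"
    and "free_product_map G' H' f g (free_product_class G H w)
      = free_product_class G' H' (map (map_sum f g) w)"
proof -
  interpret f: group_hom G G' f using assms by (simp add: group_hom_def group_hom_axioms_def)
  interpret g: group_hom H H' g using assms by (simp add: group_hom_def group_hom_axioms_def)
  have words: "map (map_sum f g) u \<in> free_product_words G' H'"
    if "u \<in> free_product_words G H" for u
    using that by (induction rule: free_product_words_induct) simp_all
  have cong: "free_product_cong G' H' (map (map_sum f g) u) (map (map_sum f g) v)"
    if "free_product_cong G H u v" for u v
    using that
  proof induction
    case (refl u)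
    then show ?case by (intro free_product_cong.refl words)
  next
    case (sym u v)
    then show ?case by (intro free_product_cong.sym[of _ _ "map (map_sum f g) u"])
  next
    case (trans u v w)
    show ?case by (rule free_product_cong.trans[OF trans.IH])
  next
    case (append u u' v v')
    then show ?case by (simp add: free_product_cong.append)
  qed (simp_all add: free_product_cong.intros(5-8))
  show "map (map_sum f g) w \<in> free_product_words G' H'"
    by (rule words[OF w])
  show "free_product_map G' H' f g (free_product_class G H w)
      = free_product_class G' H' (map (map_sum f g) w)"
    unfolding free_product_map_def
    using w by (rule free_product_the_elem)
      (simp add: free_product_class_eq_iff words[OF w] cong free_product_cong.sym)
qed

lemma free_product_map_hom:
  assumes "group G" "group H" "group G'" "group H'" "f \<in> hom G G'" "g \<in> hom H H'"
  shows "free_product_map G' H' f g \<in> hom (free_product G H) (free_product G' H')"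
    and "x \<in> carrier G
      \<Longrightarrow> free_product_map G' H' f g (free_product_inl G H x) = free_product_inl G' H' (f x)"
    and "y \<in> carrier H
      \<Longrightarrow> free_product_map G' H' f g (free_product_inr G H y) = free_product_inr G' H' (g y)"
proof -
  note map = free_product_map_class[OF assms]
  show "free_product_map G' H' f g \<in> hom (free_product G H) (free_product G' H')"
  proof (rule homI)
    fix X assume "X \<in> carrier (free_product G H)"
    then show "free_product_map G' H' f g X \<in> carrier (free_product G' H')"
      using map by (auto simp: free_product_def)
  next
    fix X Y assume XY: "X \<in> carrier (free_product G H)" "Y \<in> carrier (free_product G H)"
    obtain u v where "u \<in> free_product_words G H" "X = free_product_class G H u"
      "v \<in> free_product_words G H" "Y = free_product_class G H v"
      using XY by (auto simp: free_product_def)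
    then show "free_product_map G' H' f g (X \<otimes>\<^bsub>free_product G H\<^esub> Y)
        = free_product_map G' H' f g X \<otimes>\<^bsub>free_product G' H'\<^esub> free_product_map G' H' f g Y"
      by (simp add: free_product_mult map)
  qed
  show "free_product_map G' H' f g (free_product_inl G H x) = free_product_inl G' H' (f x)"
    if "x \<in> carrier G"
    using that map(2)[of "[Inl x]"] by (simp add: free_product_inl_def)
  show "free_product_map G' H' f g (free_product_inr G H y) = free_product_inr G' H' (g y)"
    if "y \<in> carrier H"
    using that map(2)[of "[Inr y]"] by (simp add: free_product_inr_def)
qed

definition in_V3 :: "('a, 'c) monoid_scheme \<Rightarrow> bool" where
  "in_V3 G \<longleftrightarrow> group G \<and> (\<forall>x\<in>carrier G. x [^]\<^bsub>G\<^esub> (3::nat) = \<one>\<^bsub>G\<^esub>)"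

definition normal_closure :: "('a, 'c) monoid_scheme \<Rightarrow> 'a set \<Rightarrow> 'a set" where
  "normal_closure G S = generate G (\<Union>g\<in>carrier G. (\<lambda>s. g \<otimes>\<^bsub>G\<^esub> s \<otimes>\<^bsub>G\<^esub> inv\<^bsub>G\<^esub> g) ` S)"

definition V3_coproduct_kernel ::
  "('a, 'c) monoid_scheme \<Rightarrow> ('b, 'd) monoid_scheme \<Rightarrow> ('a + 'b) list set set" where
  "V3_coproduct_kernel G H =
    normal_closure (free_product G H)
      ((\<lambda>x. x [^]\<^bsub>free_product G H\<^esub> (3::nat)) ` carrier (free_product G H))"

definition V3_coproduct ::
  "('a, 'c) monoid_scheme \<Rightarrow> ('b, 'd) monoid_scheme \<Rightarrow> ('a + 'b) list set set monoid" where
  "V3_coproduct G H = free_product G H Mod V3_coproduct_kernel G H"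

definition V3_proj ::
  "('a, 'c) monoid_scheme \<Rightarrow> ('b, 'd) monoid_scheme \<Rightarrow> ('a + 'b) list set \<Rightarrow> ('a + 'b) list set set"
  where "V3_proj G H X = V3_coproduct_kernel G H #>\<^bsub>free_product G H\<^esub> X"

definition V3_inl ::
  "('a, 'c) monoid_scheme \<Rightarrow> ('b, 'd) monoid_scheme \<Rightarrow> 'a \<Rightarrow> ('a + 'b) list set set" where
  "V3_inl G H x = V3_proj G H (free_product_inl G H x)"

definition V3_inr ::
  "('a, 'c) monoid_scheme \<Rightarrow> ('b, 'd) monoid_scheme \<Rightarrow> 'b \<Rightarrow> ('a + 'b) list set set" where
  "V3_inr G H y = V3_proj G H (free_product_inr G H y)"

text \<open>As before, \<open>G\<close> and \<open>H\<close> are the factors of the codomain.\<close>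

definition V3_coproduct_map ::
  "('c, 'e) monoid_scheme \<Rightarrow> ('d, 'f) monoid_scheme \<Rightarrow> ('a \<Rightarrow> 'c) \<Rightarrow> ('b \<Rightarrow> 'd)
    \<Rightarrow> ('a + 'b) list set set \<Rightarrow> ('c + 'd) list set set" where
  "V3_coproduct_map G H f g C = the_elem ((\<lambda>X. V3_proj G H (free_product_map G H f g X)) ` C)"

lemma normal_closure_normal:
  assumes "group G" "S \<subseteq> carrier G"
  shows "normal_closure G S \<lhd> G" "S \<subseteq> normal_closure G S"
proof -
  interpret group G by fact
  let ?T = "\<Union>g\<in>carrier G. (\<lambda>s. g \<otimes>\<^bsub>G\<^esub> s \<otimes>\<^bsub>G\<^esub> inv\<^bsub>G\<^esub> g) ` S"
  show "normal_closure G S \<lhd> G"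
    unfolding normal_closure_def
  proof (rule normal_generateI)
    show "?T \<subseteq> carrier G" using assms(2) by auto
    fix t g assume "t \<in> ?T" and g: "g \<in> carrier G"
    then obtain a s where as: "a \<in> carrier G" "s \<in> S" "t = a \<otimes>\<^bsub>G\<^esub> s \<otimes>\<^bsub>G\<^esub> inv\<^bsub>G\<^esub> a"
      by blast
    moreover have "s \<in> carrier G" using as assms(2) by blast
    ultimately have "g \<otimes>\<^bsub>G\<^esub> t \<otimes>\<^bsub>G\<^esub> inv\<^bsub>G\<^esub> g = (g \<otimes>\<^bsub>G\<^esub> a) \<otimes>\<^bsub>G\<^esub> s \<otimes>\<^bsub>G\<^esub> inv\<^bsub>G\<^esub> (g \<otimes>\<^bsub>G\<^esub> a)"
      using g by (simp add: m_assoc inv_mult_group)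
    moreover have "g \<otimes>\<^bsub>G\<^esub> a \<in> carrier G" using g as by simp
    ultimately show "g \<otimes>\<^bsub>G\<^esub> t \<otimes>\<^bsub>G\<^esub> inv\<^bsub>G\<^esub> g \<in> ?T"
      using as(2) by blast
  qed
  show "S \<subseteq> normal_closure G S"
  proof
    fix s assume "s \<in> S"
    moreover from this have "s = \<one>\<^bsub>G\<^esub> \<otimes>\<^bsub>G\<^esub> s \<otimes>\<^bsub>G\<^esub> inv\<^bsub>G\<^esub> \<one>\<^bsub>G\<^esub>" using assms(2) by auto
    ultimately have "s \<in> ?T" by blast
    then show "s \<in> normal_closure G S"
      unfolding normal_closure_def by (rule generate.incl)
  qed
qed

lemma normal_closure_minimal:
  assumes "N \<lhd> G" "S \<subseteq> N"
  shows "normal_closure G S \<subseteq> N"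
proof -
  interpret normal N G by fact
  show ?thesis
    unfolding normal_closure_def
    using assms(2) by (intro generate_subgroup_incl is_subgroup) (auto intro: inv_op_closed2)
qed

lemma V3_coproduct_kernel_normal:
  assumes "group G" "group H"
  shows "V3_coproduct_kernel G H \<lhd> free_product G H"
proof -
  interpret F: group "free_product G H" by (rule free_product_group[OF assms])
  show ?thesis
    unfolding V3_coproduct_kernel_def by (rule normal_closure_normal) auto
qed

lemma V3_coproduct_kernel_hom:
  assumes "group G" "group H" "in_V3 K" "h \<in> hom (free_product G H) K"
    and "X \<in> V3_coproduct_kernel G H"
  shows "h X = \<one>\<^bsub>K\<^esub>"
proof -
  interpret F: group "free_product G H" by (rule free_product_group[OF assms(1,2)])
  interpret K: group K using assms(3) by (simp add: in_V3_def)
  interpret h: group_hom "free_product G H" K h by unfold_locales fact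
  have "V3_coproduct_kernel G H \<subseteq> kernel (free_product G H) K h"
    unfolding V3_coproduct_kernel_def
  proof (rule normal_closure_minimal[OF h.normal_kernel], safe)
    fix X assume X: "X \<in> carrier (free_product G H)"
    then show "X [^]\<^bsub>free_product G H\<^esub> (3::nat) \<in> kernel (free_product G H) K h"
      using assms(3) by (simp add: kernel_def h.hom_nat_pow in_V3_def)
  qed
  then show ?thesis using assms(5) by (auto simp: kernel_def)
qed

lemma V3_proj_hom:
  assumes "group G" "group H"
  shows "V3_proj G H \<in> hom (free_product G H) (V3_coproduct G H)"
    and "V3_proj G H ` carrier (free_product G H) = carrier (V3_coproduct G H)"
proof -
  interpret normal "V3_coproduct_kernel G H" "free_product G H"
    by (rule V3_coproduct_kernel_normal[OF assms])
  have "V3_proj G H = (\<lambda>X. V3_coproduct_kernel G H #>\<^bsub>free_product G H\<^esub> X)"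
    by (rule ext) (simp add: V3_proj_def)
  then show "V3_proj G H \<in> hom (free_product G H) (V3_coproduct G H)"
    using r_coset_hom_Mod by (simp add: V3_coproduct_def)
  show "V3_proj G H ` carrier (free_product G H) = carrier (V3_coproduct G H)"
    by (auto simp: V3_proj_def V3_coproduct_def carrier_FactGroup)
qed

lemma V3_coproduct_in_V3:
  assumes "group G" "group H"
  shows "in_V3 (V3_coproduct G H)"
proof -
  interpret N: normal "V3_coproduct_kernel G H" "free_product G H"
    by (rule V3_coproduct_kernel_normal[OF assms])
  have grp: "group (V3_coproduct G H)"
    unfolding V3_coproduct_def by (rule N.factorgroup_is_group)
  interpret p: group_hom "free_product G H" "V3_coproduct G H" "V3_proj G H"
    using grp V3_proj_hom(1)[OF assms] N.is_group by (simp add: group_hom_def group_hom_axioms_def)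
  have "C [^]\<^bsub>V3_coproduct G H\<^esub> (3::nat) = \<one>\<^bsub>V3_coproduct G H\<^esub>"
    if C: "C \<in> carrier (V3_coproduct G H)" for C
  proof -
    obtain X where X: "X \<in> carrier (free_product G H)" "C = V3_proj G H X"
      using C unfolding V3_proj_hom(2)[OF assms, symmetric] by blast
    have "(\<lambda>x. x [^]\<^bsub>free_product G H\<^esub> (3::nat)) ` carrier (free_product G H)
        \<subseteq> V3_coproduct_kernel G H"
      unfolding V3_coproduct_kernel_def by (rule normal_closure_normal(2)[OF N.is_group]) auto
    then have "X [^]\<^bsub>free_product G H\<^esub> (3::nat) \<in> V3_coproduct_kernel G H"
      using X(1) by blast
    then have "V3_coproduct_kernel G H #>\<^bsub>free_product G H\<^esub> (X [^]\<^bsub>free_product G H\<^esub> (3::nat))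
        = V3_coproduct_kernel G H"
      by (intro N.coset_join2 N.nat_pow_closed X(1) N.is_subgroup)
    then have "V3_proj G H (X [^]\<^bsub>free_product G H\<^esub> (3::nat)) = \<one>\<^bsub>V3_coproduct G H\<^esub>"
      by (simp add: V3_proj_def V3_coproduct_def)
    then show ?thesis unfolding X(2) using p.hom_nat_pow[OF X(1), of 3] by simp
  qed
  with grp show ?thesis by (simp add: in_V3_def)
qed

lemma V3_inl_hom:
  assumes "group G" "group H"
  shows "V3_inl G H \<in> hom G (V3_coproduct G H)"
  using hom_compose[OF free_product_inl_hom[OF assms(1)] V3_proj_hom(1)[OF assms]]
  by (simp add: V3_inl_def[abs_def] comp_def)

lemma V3_inr_hom:
  assumes "group G" "group H"
  shows "V3_inr G H \<in> hom H (V3_coproduct G H)"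
  using hom_compose[OF free_product_inr_hom[OF assms(2)] V3_proj_hom(1)[OF assms]]
  by (simp add: V3_inr_def[abs_def] comp_def)

lemma V3_proj_factor:
  assumes "group G" "group H" "in_V3 K" "h \<in> hom (free_product G H) K"
  shows "(\<lambda>C. the_elem (h ` C)) \<in> hom (V3_coproduct G H) K"
    and "X \<in> carrier (free_product G H) \<Longrightarrow> the_elem (h ` V3_proj G H X) = h X"
proof -
  interpret N: normal "V3_coproduct_kernel G H" "free_product G H"
    by (rule V3_coproduct_kernel_normal[OF assms(1,2)])
  interpret K: group K using assms(3) by (simp add: in_V3_def)
  interpret h: group_hom "free_product G H" K h by unfold_locales fact
  have *: "the_elem (h ` V3_proj G H X) = h X" if X: "X \<in> carrier (free_product G H)" for X
  proof (rule the_elem_image_unique)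
    show "V3_proj G H X \<noteq> {}"
      using N.rcos_self[OF X N.is_subgroup] unfolding V3_proj_def by blast
    fix Y assume "Y \<in> V3_proj G H X"
    then obtain k where k: "k \<in> V3_coproduct_kernel G H" "Y = k \<otimes>\<^bsub>free_product G H\<^esub> X"
      by (auto simp: V3_proj_def r_coset_def)
    moreover have "k \<in> carrier (free_product G H)" using k N.subset by blast
    ultimately show "h Y = h X"
      using X V3_coproduct_kernel_hom[OF assms k(1)] by simp
  qed
  show "(\<lambda>C. the_elem (h ` C)) \<in> hom (V3_coproduct G H) K"
  proof (rule homI)
    fix C assume "C \<in> carrier (V3_coproduct G H)"
    then show "the_elem (h ` C) \<in> carrier K"
      unfolding V3_proj_hom(2)[OF assms(1,2), symmetric] by (auto simp: *)
  next
    fix C D assume "C \<in> carrier (V3_coproduct G H)" "D \<in> carrier (V3_coproduct G H)"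
    then obtain X Y where XY: "X \<in> carrier (free_product G H)" "C = V3_proj G H X"
      "Y \<in> carrier (free_product G H)" "D = V3_proj G H Y"
      unfolding V3_proj_hom(2)[OF assms(1,2), symmetric] by auto
    have "C \<otimes>\<^bsub>V3_coproduct G H\<^esub> D = V3_proj G H (X \<otimes>\<^bsub>free_product G H\<^esub> Y)"
      using XY hom_mult[OF V3_proj_hom(1)[OF assms(1,2)]] by simp
    then show "the_elem (h ` (C \<otimes>\<^bsub>V3_coproduct G H\<^esub> D)) = the_elem (h ` C) \<otimes>\<^bsub>K\<^esub> the_elem (h ` D)"
      using XY by (simp add: *)
  qed
  show "the_elem (h ` V3_proj G H X) = h X" if "X \<in> carrier (free_product G H)"
    by (rule *[OF that])
qed

lemma V3_coproduct_universal:
  assumes "group G" "group H" "in_V3 K" "f \<in> hom G K" "g \<in> hom H K"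
  obtains h where "h \<in> hom (V3_coproduct G H) K"
    "\<And>x. x \<in> carrier G \<Longrightarrow> h (V3_inl G H x) = f x"
    "\<And>y. y \<in> carrier H \<Longrightarrow> h (V3_inr G H y) = g y"
proof -
  have "group K" using assms(3) by (simp add: in_V3_def)
  then obtain k where k: "k \<in> hom (free_product G H) K"
    "\<And>x. x \<in> carrier G \<Longrightarrow> k (free_product_inl G H x) = f x"
    "\<And>y. y \<in> carrier H \<Longrightarrow> k (free_product_inr G H y) = g y"
    using free_product_universal[OF assms(1,2) _ assms(4,5)] by metis
  note factor = V3_proj_factor[OF assms(1-3) k(1)]
  show thesis
  proof (rule that[OF factor(1)])
    show "the_elem (k ` V3_inl G H x) = f x" if "x \<in> carrier G" for x
      using that hom_in_carrier[OF free_product_inl_hom[OF assms(1)] that, of H]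
      by (simp add: V3_inl_def factor(2) k(2))
    show "the_elem (k ` V3_inr G H y) = g y" if "y \<in> carrier H" for y
      using that hom_in_carrier[OF free_product_inr_hom[OF assms(2)] that, of G]
      by (simp add: V3_inr_def factor(2) k(3))
  qed
qed

lemma V3_coproduct_hom_unique:
  assumes "group G" "group H" "group K"
    and h: "h \<in> hom (V3_coproduct G H) K" and h': "h' \<in> hom (V3_coproduct G H) K"
    and inl': "\<And>x. x \<in> carrier G \<Longrightarrow> h (V3_inl G H x) = h' (V3_inl G H x)"
    and inr': "\<And>y. y \<in> carrier H \<Longrightarrow> h (V3_inr G H y) = h' (V3_inr G H y)"
    and C: "C \<in> carrier (V3_coproduct G H)"
  shows "h C = h' C"
proof -
  note pin = hom_in_carrier[OF V3_proj_hom(1)[OF assms(1,2)]]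
    and pmult = hom_mult[OF V3_proj_hom(1)[OF assms(1,2)]]
    and lin = hom_in_carrier[OF free_product_inl_hom[OF assms(1)], of _ H]
    and rin = hom_in_carrier[OF free_product_inr_hom[OF assms(2)], of _ G]
  have "group (V3_coproduct G H)"
    using V3_coproduct_in_V3[OF assms(1,2)] by (simp add: in_V3_def)
  have proj_one: "V3_proj G H \<one>\<^bsub>free_product G H\<^esub> = \<one>\<^bsub>V3_coproduct G H\<^esub>"
    using hom_one[OF V3_proj_hom(1)[OF assms(1,2)] free_product_group[OF assms(1,2)]]
      \<open>group (V3_coproduct G H)\<close> by simp
  obtain X where X: "X \<in> carrier (free_product G H)" "C = V3_proj G H X"
    using C unfolding V3_proj_hom(2)[OF assms(1,2), symmetric] by blast
  have "h (V3_proj G H X) = h' (V3_proj G H X)"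
    using X(1)
  proof (induction rule: free_product_induct)
    case one
    show ?case
      using hom_one[OF h \<open>group (V3_coproduct G H)\<close> assms(3)]
        hom_one[OF h' \<open>group (V3_coproduct G H)\<close> assms(3)]
      by (simp add: proj_one)
  next
    case (inl x Y)
    then show ?case
      using inl'[of x] by (simp add: pmult lin pin hom_mult[OF h] hom_mult[OF h'] V3_inl_def)
  next
    case (inr y Y)
    then show ?case
      using inr'[of y] by (simp add: pmult rin pin hom_mult[OF h] hom_mult[OF h'] V3_inr_def)
  qed
  with X(2) show ?thesis by simp
qed

lemma V3_coproduct_map_hom:
  assumes "group G" "group H" "group G'" "group H'" "f \<in> hom G G'" "g \<in> hom H H'"
  shows "V3_coproduct_map G' H' f g \<in> hom (V3_coproduct G H) (V3_coproduct G' H')"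
    and "x \<in> carrier G \<Longrightarrow> V3_coproduct_map G' H' f g (V3_inl G H x) = V3_inl G' H' (f x)"
    and "y \<in> carrier H \<Longrightarrow> V3_coproduct_map G' H' f g (V3_inr G H y) = V3_inr G' H' (g y)"
proof -
  let ?k = "\<lambda>X. V3_proj G' H' (free_product_map G' H' f g X)"
  note map = free_product_map_hom[OF assms]
  have k: "?k \<in> hom (free_product G H) (V3_coproduct G' H')"
    using hom_compose[OF map(1) V3_proj_hom(1)[OF assms(3,4)]] by (simp add: comp_def)
  note factor = V3_proj_factor[OF assms(1,2) V3_coproduct_in_V3[OF assms(3,4)] k]
  show "V3_coproduct_map G' H' f g \<in> hom (V3_coproduct G H) (V3_coproduct G' H')"
    using factor(1) by (simp add: V3_coproduct_map_def[abs_def])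
  show "V3_coproduct_map G' H' f g (V3_inl G H x) = V3_inl G' H' (f x)" if "x \<in> carrier G"
    using that hom_in_carrier[OF free_product_inl_hom[OF assms(1)] that, of H]
    by (simp add: V3_coproduct_map_def V3_inl_def factor(2) map(2))
  show "V3_coproduct_map G' H' f g (V3_inr G H y) = V3_inr G' H' (g y)" if "y \<in> carrier H"
    using that hom_in_carrier[OF free_product_inr_hom[OF assms(2)] that, of G]
    by (simp add: V3_coproduct_map_def V3_inr_def factor(2) map(3))
qed

definition commutator_subgroup :: "('a, 'c) monoid_scheme \<Rightarrow> 'a set \<Rightarrow> 'a set \<Rightarrow> 'a set" where
  "commutator_subgroup G A B =
    generate G (\<Union>a\<in>A. \<Union>b\<in>B. {a \<otimes>\<^bsub>G\<^esub> b \<otimes>\<^bsub>G\<^esub> inv\<^bsub>G\<^esub> a \<otimes>\<^bsub>G\<^esub> inv\<^bsub>G\<^esub> b})"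

text \<open>Indexed from 1; the value at 0 is a dummy.\<close>

fun lower_central :: "('a, 'c) monoid_scheme \<Rightarrow> nat \<Rightarrow> 'a set" where
  "lower_central G 0 = carrier G"
| "lower_central G (Suc 0) = carrier G"
| "lower_central G (Suc (Suc n)) =
    commutator_subgroup G (lower_central G (Suc n)) (carrier G)"

definition LCS_subgroup :: "'a set \<Rightarrow> ('a, 'c) monoid_scheme \<Rightarrow> bool" where
  "LCS_subgroup D G \<longleftrightarrow> subgroup D G \<and>
    lower_central (G\<lparr>carrier := D\<rparr>) 2 = lower_central G 2 \<inter> D \<and>
    lower_central (G\<lparr>carrier := D\<rparr>) 3 = lower_central G 3 \<inter> D"

end

theory Submission
  imports Defs
begin

text \<open>
  A group of exponent 3 has class at most 3, and \<open>[x, y, z]\<close> is alternating. Modulo \<open>\<gamma>\<^sub>3\<close> it becomes a vector space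
  over the field with 3 elements under \<open>x \<circ> y = x y [x, y]\<close>. In a coproduct \<open>P = D * B\<close> every element has the form \<open>d b c\<close>
  with \<open>c\<close> in the abelian subgroup \<open>C\<close> generated by the commutators \<open>[d, b]\<close>, and \<open>[d, b]\<close> is \<open>\<circ>\<close>-bilinear and trivial
  on \<open>\<gamma>\<^sub>2(D) \<times> \<gamma>\<^sub>2(B)\<close>. The hypothesis on \<open>D\<close> yields a \<open>\<circ>\<close>-linear retraction \<open>r\<close> of \<open>G\<close> onto \<open>D\<close> modulo \<open>\<gamma>\<^sub>3\<close> that maps
  \<open>\<gamma>\<^sub>2(G)\<close> to \<open>\<gamma>\<^sub>2(D)\<close>; let \<open>s\<close> be such a retraction of \<open>B\<close> onto \<open>\<gamma>\<^sub>2(B)\<close>. Whenever \<open>\<beta>(x, y)\<close> is \<open>\<circ>\<close>-linear in \<open>x \<in> X\<close> and a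
  homomorphism in \<open>y \<in> Y\<close>, some group of exponent 3 inside the wreath product of the target with \<open>X\<close> receives \<open>X\<close> and \<open>Y\<close>
  so that \<open>[x, y]\<close> evaluates to \<open>\<beta>(x, y)\<close>. Applied to \<open>[r g, b] [r g, s b]\<^sup>-\<^sup>1\<close> and to \<open>[r g, s b]\<close>, this recovers
  every \<open>c \<in> C\<close> from its image in \<open>G * B\<close>.
\<close>

subsection \<open>Groups of exponent 3\<close>

definition commutator :: "('a, 'c) monoid_scheme \<Rightarrow> 'a \<Rightarrow> 'a \<Rightarrow> 'a" where
  "commutator G x y = x \<otimes>\<^bsub>G\<^esub> y \<otimes>\<^bsub>G\<^esub> inv\<^bsub>G\<^esub> x \<otimes>\<^bsub>G\<^esub> inv\<^bsub>G\<^esub> y"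

locale V3_group = group +
  assumes cube: "x \<in> carrier G \<Longrightarrow> x \<otimes> (x \<otimes> x) = \<one>"
begin

lemma cancel [simp]:
  assumes "x \<in> carrier G" "y \<in> carrier G"
  shows "x \<otimes> (inv x \<otimes> y) = y" "inv x \<otimes> (x \<otimes> y) = y"
  using assms by (simp_all flip: m_assoc)

lemma cube_cancel: 
  assumes "x \<in> carrier G" "y \<in> carrier G"
  shows "x \<otimes> (x \<otimes> (x \<otimes> y)) = y"
  using cube[OF assms(1)] assms by (metis l_one m_assoc m_closed)

lemma inv_eq_square: "x \<in> carrier G \<Longrightarrow> inv x = x \<otimes> x"
  using cube inv_equality[of "x \<otimes> x" x] by (simp add: m_assoc)

definition conj :: "'a \<Rightarrow> 'a \<Rightarrow> 'a" where "conj g x = g \<otimes> x \<otimes> inv g"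

lemma conj_closed [simp]: "g \<in> carrier G \<Longrightarrow> x \<in> carrier G \<Longrightarrow> conj g x \<in> carrier G"
  by (simp add: conj_def)

lemma conj_conj: "\<lbrakk>g \<in> carrier G; h \<in> carrier G; x \<in> carrier G\<rbrakk> \<Longrightarrow> conj g (conj h x) = conj (g \<otimes> h) x"
  by (simp add: conj_def inv_mult_group m_assoc)

lemma conj_mult: "\<lbrakk>g \<in> carrier G; x \<in> carrier G; y \<in> carrier G\<rbrakk> \<Longrightarrow> conj g (x \<otimes> y) = conj g x \<otimes> conj g y"
  by (simp add: conj_def m_assoc)

lemma conj_one [simp]: "x \<in> carrier G \<Longrightarrow> conj \<one> x = x" "g \<in> carrier G \<Longrightarrow> conj g \<one> = \<one>"
  by (simp_all add: conj_def)

text \<open>This is \<open>(a y)\<^sup>3 = 1\<close>: the operator \<open>1 + y + y\<^sup>2\<close> vanishes on the normal closure of \<open>a\<close>.\<close>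

lemma conj_norm:
  assumes "a \<in> carrier G" "y \<in> carrier G"
  shows "a \<otimes> (conj y a \<otimes> conj (y \<otimes> y) a) = \<one>"
proof -
  have "a \<otimes> (conj y a \<otimes> conj (y \<otimes> y) a) = (a \<otimes> y) \<otimes> ((a \<otimes> y) \<otimes> (a \<otimes> (inv y \<otimes> inv y)))"
    using assms by (simp add: conj_def m_assoc inv_mult_group)
  also have "inv y \<otimes> inv y = y"
    using assms inv_eq_square[of "inv y"] by simp
  finally show ?thesis
    using assms cube[of "a \<otimes> y"] by simp
qed

text \<open>From \<open>(x z)^3 = 1\<close> one gets \<open>x z x = z^-1 x^-1 z^-1\<close>. Used
  with \<open>z = y\<close> and with \<open>z = y^-1\<close>, this turns both sides into
  \<open>y^-1 x^-1 y\<close>.\<close>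

lemma conj_commute:
  assumes "x \<in> carrier G" "y \<in> carrier G"
  shows "x \<otimes> conj y x = conj y x \<otimes> x"
proof -
  have flip: "x \<otimes> (z \<otimes> x) = inv z \<otimes> (inv x \<otimes> inv z)" if "z \<in> carrier G" for z
  proof -
    have "x \<otimes> (z \<otimes> x) = inv ((z \<otimes> x) \<otimes> z) "
      using that assms inv_equality[of "x \<otimes> (z \<otimes> x)" "(z \<otimes> x) \<otimes> z"] cube[of "x \<otimes> z"]
      by (metis inv_equality m_assoc m_closed)
    then show ?thesis using that assms by (simp add: inv_mult_group m_assoc)
  qed
  have "x \<otimes> conj y x = (x \<otimes> (y \<otimes> x)) \<otimes> inv y"
    using assms by (simp add: conj_def m_assoc)
  also have "\<dots> = inv y \<otimes> (inv x \<otimes> (inv y \<otimes> inv y))"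
    using assms flip[of y] by (simp add: m_assoc)
  also have "inv y \<otimes> inv y = y"
    using assms inv_eq_square[of "inv y"] by simp
  finally have 1: "x \<otimes> conj y x = inv y \<otimes> (inv x \<otimes> y)" .
  have "conj y x \<otimes> x = y \<otimes> (x \<otimes> (inv y \<otimes> x))"
    using assms by (simp add: conj_def m_assoc)
  also have "\<dots> = y \<otimes> y \<otimes> (inv x \<otimes> y)"
    using assms flip[of "inv y"] by (simp add: m_assoc)
  also have "\<dots> = inv y \<otimes> (inv x \<otimes> y)"
    using assms by (simp add: inv_eq_square)
  finally show ?thesis using 1 by simp
qed

text \<open>\<open>conj h x\<close> is itself a conjugate of \<open>conj g x\<close>. So the normal
  closure of \<open>x\<close> is abelian, and conjugations act on it as linear operators.\<close>

lemma conj_conj_commute: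
  assumes "x \<in> carrier G" "g \<in> carrier G" "h \<in> carrier G"
  shows "conj g x \<otimes> conj h x = conj h x \<otimes> conj g x"
proof -
  have "conj g x \<otimes> conj (h \<otimes> inv g) (conj g x) = conj (h \<otimes> inv g) (conj g x) \<otimes> conj g x"
    using assms by (intro conj_commute) auto
  moreover have "conj (h \<otimes> inv g) (conj g x) = conj h x"
    using assms by (simp add: conj_conj m_assoc)
  ultimately show ?thesis by simp
qed

text \<open>On the abelian normal closure of \<open>x\<close>, written additively, this says \<open>(y - 1)(z - 1) + (z - 1)(y - 1) = 0\<close>.
  It comes from \<open>1 + g + g\<^sup>2 = 0\<close> for \<open>g = yz\<close>, which gives \<open>zyz = 1 + y - z\<close>.\<close>

lemma conj_polarised:
  assumes "x \<in> carrier G" "y \<in> carrier G" "z \<in> carrier G"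
  shows "conj (z \<otimes> y) x \<otimes> (x \<otimes> (x \<otimes> (conj z x \<otimes> (conj y x \<otimes> conj (y \<otimes> z) x)))) = \<one>"
proof -
  \<comment> \<open>Additively \<open>z y z + z = 1 + y\<close>. Both sides are the negative of
    \<open>y^-1\<close>: the left one by the norm relation for \<open>y z\<close> translated by
    \<open>y^-1\<close>, the right one by the norm relation for \<open>y\<close>.\<close>
  have A: "conj (z \<otimes> (y \<otimes> z)) a \<otimes> conj z a = a \<otimes> conj y a" if a: "a \<in> carrier G" for a
  proof -
    have "conj (inv y) (a \<otimes> (conj (y \<otimes> z) a \<otimes> conj (y \<otimes> z \<otimes> (y \<otimes> z)) a)) = \<one>"
      using assms a by (simp add: conj_norm)
    then have 1: "conj (inv y) a \<otimes> (conj z a \<otimes> conj (z \<otimes> (y \<otimes> z)) a) = \<one>"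
      using assms a by (simp add: conj_mult conj_conj m_assoc)
    have 2: "a \<otimes> (conj y a \<otimes> conj (inv y) a) = \<one>"
      using conj_norm[OF a assms(2)] assms a by (simp add: inv_eq_square)
    have "(a \<otimes> conj y a) = inv (conj (inv y) a)"
      using 2 assms a by (intro inv_equality[symmetric]) (simp_all add: m_assoc)
    moreover have "conj z a \<otimes> conj (z \<otimes> (y \<otimes> z)) a = inv (conj (inv y) a)"
      using 1 assms a by (metis (no_types) conj_closed inv_closed inv_equality inv_inv m_closed)
    moreover have "conj z a \<otimes> conj (z \<otimes> (y \<otimes> z)) a = conj (z \<otimes> (y \<otimes> z)) a \<otimes> conj z a"
      using assms a by (intro conj_conj_commute) auto
    ultimately show ?thesis by simp
  qed
  have 1: "conj (z \<otimes> y) x \<otimes> x = conj (inv z) x \<otimes> conj (y \<otimes> inv z) x"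
    using A[of "conj (inv z) x"] assms by (simp add: conj_conj m_assoc)
  \<comment> \<open>The norm relation for \<open>z\<close>, translated by \<open>g\<close>. Once
    \<open>1\<close> has replaced \<open>z y + 1\<close> by \<open>z^-1 + y z^-1\<close>, the whole
    sum splits into this relation for \<open>g = 1\<close> and for \<open>g = y\<close>.\<close>
  have B: "conj (g \<otimes> inv z) x \<otimes> (conj g x \<otimes> conj (g \<otimes> z) x) = \<one>" if g: "g \<in> carrier G" for g
  proof -
    have "conj g (conj (inv z) x \<otimes> (conj z (conj (inv z) x) \<otimes> conj (z \<otimes> z) (conj (inv z) x))) = \<one>"
      using assms g by (simp add: conj_norm)
    then show ?thesis using assms g by (simp add: conj_mult conj_conj m_assoc)
  qed
  have "conj (z \<otimes> y) x \<otimes> (x \<otimes> (x \<otimes> (conj z x \<otimes> (conj y x \<otimes> conj (y \<otimes> z) x))))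
    = conj (inv z) x \<otimes> (conj (y \<otimes> inv z) x \<otimes> (x \<otimes> conj z x)) \<otimes> (conj y x \<otimes> conj (y \<otimes> z) x)"
    using 1 assms by (simp flip: m_assoc)
  also have "conj (y \<otimes> inv z) x \<otimes> (x \<otimes> conj z x) = (x \<otimes> conj z x) \<otimes> conj (y \<otimes> inv z) x"
    using assms conj_conj_commute[of x "y \<otimes> inv z" \<one>] conj_conj_commute[of x "y \<otimes> inv z" z]
    by simp (metis conj_closed inv_closed m_assoc m_closed)
  finally have "conj (z \<otimes> y) x \<otimes> (x \<otimes> (x \<otimes> (conj z x \<otimes> (conj y x \<otimes> conj (y \<otimes> z) x))))
    = (conj (inv z) x \<otimes> (x \<otimes> conj z x)) \<otimes> (conj (y \<otimes> inv z) x \<otimes> (conj y x \<otimes> conj (y \<otimes> z) x))"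
    using assms by (simp add: m_assoc)
  then show ?thesis
    using B[of \<one>] B[of y] assms by simp
qed

end

section \<open>Commutators and centralizers in a group\<close>

lemma (in group) commutator_closed [simp]:
  "\<lbrakk>x \<in> carrier G; y \<in> carrier G\<rbrakk> \<Longrightarrow> commutator G x y \<in> carrier G"
  by (simp add: commutator_def)

lemma (in group) inv_commutator:
  "\<lbrakk>x \<in> carrier G; y \<in> carrier G\<rbrakk> \<Longrightarrow> inv (commutator G x y) = commutator G y x"
  by (simp add: commutator_def inv_mult_group m_assoc)

lemma (in group) commutator_eq_one_iff:
  assumes "x \<in> carrier G" "y \<in> carrier G"
  shows "commutator G x y = \<one> \<longleftrightarrow> x \<otimes> y = y \<otimes> x"
proof -
  have "commutator G x y = (x \<otimes> y) \<otimes> inv (y \<otimes> x)"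
    using assms by (simp add: commutator_def m_assoc inv_mult_group)
  then show ?thesis
    using assms by (metis inv_solve_right m_closed one_closed l_one)
qed

lemma (in group) centralizer_subgroup:
  assumes "S \<subseteq> carrier G"
  shows "subgroup {z \<in> carrier G. \<forall>w\<in>S. z \<otimes> w = w \<otimes> z} G"
proof (rule subgroupI)
  show "{z \<in> carrier G. \<forall>w\<in>S. z \<otimes> w = w \<otimes> z} \<noteq> {}"
    using assms by (auto intro!: exI[of _ \<one>])
next
  fix a assume a: "a \<in> {z \<in> carrier G. \<forall>w\<in>S. z \<otimes> w = w \<otimes> z}"
  have "inv a \<otimes> w = w \<otimes> inv a" if "w \<in> S" for w
  proof -
    have "a \<otimes> w = w \<otimes> a" "w \<in> carrier G" "a \<in> carrier G" using a that assms by auto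
    then show ?thesis by (metis inv_closed inv_solve_left inv_solve_right m_assoc m_closed)
  qed
  then show "inv a \<in> {z \<in> carrier G. \<forall>w\<in>S. z \<otimes> w = w \<otimes> z}" using a by simp
next
  fix a b assume ab: "a \<in> {z \<in> carrier G. \<forall>w\<in>S. z \<otimes> w = w \<otimes> z}"
    "b \<in> {z \<in> carrier G. \<forall>w\<in>S. z \<otimes> w = w \<otimes> z}"
  have "a \<otimes> b \<otimes> w = w \<otimes> (a \<otimes> b)" if "w \<in> S" for w
  proof -
    have "a \<in> carrier G" "b \<in> carrier G" "w \<in> carrier G" "a \<otimes> w = w \<otimes> a" "b \<otimes> w = w \<otimes> b"
      using ab that assms by auto
    then show ?thesis by (metis m_assoc)
  qed
  then show "a \<otimes> b \<in> {z \<in> carrier G. \<forall>w\<in>S. z \<otimes> w = w \<otimes> z}" using ab by simp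
qed auto

text \<open>The centralizer argument is used twice: first \<open>generate G S\<close> centralizes
  \<open>T\<close>, and then \<open>T\<close>, hence \<open>generate G T\<close>, lies in the
  centralizer of \<open>generate G S\<close>.\<close>

lemma (in group) generate_commute:
  assumes "S \<subseteq> carrier G" "T \<subseteq> carrier G"
    and "\<And>s t. \<lbrakk>s \<in> S; t \<in> T\<rbrakk> \<Longrightarrow> s \<otimes> t = t \<otimes> s"
    and "x \<in> generate G S" "y \<in> generate G T"
  shows "x \<otimes> y = y \<otimes> x"
proof -
  have 1: "generate G S \<subseteq> {z \<in> carrier G. \<forall>w\<in>T. z \<otimes> w = w \<otimes> z}"
    using assms by (intro generate_subgroup_incl[OF _ centralizer_subgroup[OF assms(2)]]) auto
  have 2: "generate G S \<subseteq> carrier G" using assms(1) by (rule generate_incl)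
  have "generate G T \<subseteq> {z \<in> carrier G. \<forall>w\<in>generate G S. z \<otimes> w = w \<otimes> z}"
    using assms(2) 1 2 by (intro generate_subgroup_incl[OF _ centralizer_subgroup[OF 2]]) fastforce
  then show ?thesis using assms(4,5) by auto
qed

lemma (in group) comm_group_subgroupI:
  assumes "subgroup H G" "\<And>x y. \<lbrakk>x \<in> H; y \<in> H\<rbrakk> \<Longrightarrow> x \<otimes> y = y \<otimes> x"
  shows "comm_group (G\<lparr>carrier := H\<rparr>)"
  using assms by (intro group.group_comm_groupI subgroup.subgroup_is_group) (auto intro: group_axioms)

section \<open>Commutator identities in exponent 3\<close>

context V3_group begin

lemma commutator_conj: "\<lbrakk>x \<in> carrier G; y \<in> carrier G\<rbrakk> \<Longrightarrow> commutator G x y = x \<otimes> inv (conj y x)"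
  by (simp add: commutator_def conj_def inv_mult_group m_assoc)

lemma inv_conj: "\<lbrakk>g \<in> carrier G; x \<in> carrier G\<rbrakk> \<Longrightarrow> inv (conj g x) = conj g (inv x)"
  by (simp add: conj_def inv_mult_group m_assoc)

text \<open>\<open>[x, y]\<close> is \<open>x\<close> times the inverse of a conjugate of
  \<open>x\<close>. These factors commute by \<open>conj_commute\<close>, so inverting
  \<open>x\<close> inverts the product.\<close>

lemma commutator_inv_left:
  assumes "x \<in> carrier G" "y \<in> carrier G"
  shows "commutator G (inv x) y = inv (commutator G x y)"
proof -
  have "commutator G (inv x) y = inv x \<otimes> conj y x"
    using assms by (simp add: commutator_conj inv_conj[symmetric])
  also have "\<dots> = conj y x \<otimes> inv x"
    using conj_commute[OF assms] assms by (metis conj_closed inv_closed inv_solve_left inv_solve_right m_assoc m_closed)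
  finally show ?thesis
    using assms by (simp add: commutator_conj inv_mult_group)
qed

text \<open>On the abelian normal closure \<open>N\<close> of \<open>x\<close>, written additively,
  \<open>[x, y]\<close> is \<open>(1 - y) x\<close> and \<open>[x, y, z]\<close> is
  \<open>(1 - z)(1 - y) x\<close>. Adding the version with \<open>y\<close> and \<open>z\<close>
  exchanged gives the operator of \<open>conj_polarised\<close>, which vanishes.\<close>

lemma commutator3_swap_right:
  assumes "x \<in> carrier G" "y \<in> carrier G" "z \<in> carrier G"
  shows "commutator G (commutator G x y) z = inv (commutator G (commutator G x z) y)"
proof -
  define N where "N = generate G ((\<lambda>g. conj g x) ` carrier G)"
  have N: "subgroup N G"
    unfolding N_def using assms by (intro generate_is_subgroup image_subsetI conj_closed)
  interpret N: comm_group "G\<lparr>carrier := N\<rparr>"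
  proof (rule comm_group_subgroupI[OF N])
    show "u \<otimes> v = v \<otimes> u" if "u \<in> N" "v \<in> N" for u v
    proof (rule generate_commute)
      show "(\<lambda>g. conj g x) ` carrier G \<subseteq> carrier G" using assms by auto
      then show "(\<lambda>g. conj g x) ` carrier G \<subseteq> carrier G" .
      show "u \<in> generate G ((\<lambda>g. conj g x) ` carrier G)" "v \<in> generate G ((\<lambda>g. conj g x) ` carrier G)"
        using that by (simp_all add: N_def)
    qed (auto intro: conj_conj_commute assms)
  qed
  have in_N: "conj g x \<in> N" if "g \<in> carrier G" for g
    unfolding N_def using that by (auto intro: generate.incl)
  note ac = N.m_closed[simplified] N.m_ac[simplified]
  define a p q s t where "a = x" and "p = conj y x" and "q = conj z x"
    and "s = conj (z \<otimes> y) x" and "t = conj (y \<otimes> z) x"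
  note defs = a_def p_def q_def s_def t_def
  have mem: "a \<in> N" "p \<in> N" "q \<in> N" "s \<in> N" "t \<in> N"
    using assms in_N[of \<one>] in_N by (simp_all add: defs)
  have G: "a \<in> carrier G" "p \<in> carrier G" "q \<in> carrier G" "s \<in> carrier G" "t \<in> carrier G"
    using assms by (simp_all add: defs)
  have eq: "s \<otimes> (a \<otimes> (a \<otimes> (q \<otimes> (p \<otimes> t)))) = \<one>"
    unfolding defs by (rule conj_polarised[OF assms])
  have L: "commutator G (commutator G x y) z = a \<otimes> (p \<otimes> (p \<otimes> (s \<otimes> (q \<otimes> q))))"
  proof -
    have "commutator G (commutator G x y) z = a \<otimes> inv p \<otimes> inv (q \<otimes> inv s)"
      using assms by (simp add: defs commutator_conj conj_mult inv_conj conj_conj)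
    then show ?thesis using G by (simp add: inv_mult_group inv_eq_square[of p] inv_eq_square[of q] m_assoc)
  qed
  have R: "commutator G (commutator G x z) y = a \<otimes> (q \<otimes> (q \<otimes> (t \<otimes> (p \<otimes> p))))"
  proof -
    have "commutator G (commutator G x z) y = a \<otimes> inv q \<otimes> inv (p \<otimes> inv t)"
      using assms by (simp add: defs commutator_conj conj_mult inv_conj conj_conj)
    then show ?thesis using G by (simp add: inv_mult_group inv_eq_square[of p] inv_eq_square[of q] m_assoc)
  qed
  have "commutator G (commutator G x y) z \<otimes> commutator G (commutator G x z) y
      = a \<otimes> (a \<otimes> (p \<otimes> (p \<otimes> (p \<otimes> (p \<otimes> (q \<otimes> (q \<otimes> (q \<otimes> (q \<otimes> (s \<otimes> t))))))))))"
    unfolding L R using mem G by (simp add: ac m_assoc)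
  also have "\<dots> = a \<otimes> (a \<otimes> (p \<otimes> (q \<otimes> (s \<otimes> t))))"
    using G by (simp add: cube_cancel)
  also have "\<dots> = \<one>"
    using eq mem G by (simp add: ac m_assoc)
  finally show ?thesis
    using assms by (intro inv_equality[symmetric]) simp_all
qed

lemma commutator3_swap_left:
  assumes "x \<in> carrier G" "y \<in> carrier G" "z \<in> carrier G"
  shows "commutator G (commutator G y x) z = inv (commutator G (commutator G x y) z)"
  using assms commutator_inv_left[of "commutator G x y" z] by (simp add: inv_commutator)

lemma commutator3_rotate:
  assumes "x \<in> carrier G" "y \<in> carrier G" "z \<in> carrier G"
  shows "commutator G (commutator G x y) z = commutator G (commutator G y z) x"
  using assms commutator3_swap_right[of y z x] commutator3_swap_left[of x y z] by simp

text \<open>The fourfold commutator \<open>[x, y, z, w]\<close> is alternating, so it is invariant under the even permutation exchanging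
  the pairs \<open>(x, y)\<close> and \<open>(z, w)\<close>; but it equals \<open>[[z, w], [x, y]]\<close>, which this exchange inverts.\<close>

lemma commutator4_trivial:
  assumes "x \<in> carrier G" "y \<in> carrier G" "z \<in> carrier G" "w \<in> carrier G"
  shows "commutator G (commutator G (commutator G x y) z) w = \<one>"
proof -
  define q where "q x y z w = commutator G (commutator G (commutator G x y) z) w" for x y z w
  have q_closed: "q x y z w \<in> carrier G" 
    if "x \<in> carrier G" "y \<in> carrier G" "z \<in> carrier G" "w \<in> carrier G" for x y z w
    using that by (simp add: q_def)
  have s12: "q y x z w = inv (q x y z w)"
    if "x \<in> carrier G" "y \<in> carrier G" "z \<in> carrier G" "w \<in> carrier G" for x y z w
    using that by (simp add: q_def commutator3_swap_left[of x y z] commutator_inv_left)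
  have s23: "q x z y w = inv (q x y z w)"
    if "x \<in> carrier G" "y \<in> carrier G" "z \<in> carrier G" "w \<in> carrier G" for x y z w
    using that by (simp add: q_def commutator3_swap_right[of x z y] commutator_inv_left)
  have s34: "q x y w z = inv (q x y z w)"
    if "x \<in> carrier G" "y \<in> carrier G" "z \<in> carrier G" "w \<in> carrier G" for x y z w
    using that by (simp add: q_def commutator3_swap_right[of "commutator G x y" w z])
  have pair: "q x y z w = commutator G (commutator G z w) (commutator G x y)"
    if "x \<in> carrier G" "y \<in> carrier G" "z \<in> carrier G" "w \<in> carrier G" for x y z w
    using that by (simp add: q_def commutator3_rotate[of "commutator G x y" z w])
  have "q x y z w = q z w x y"
    using assms s23[of x y z w] s12[of x z y w] s34[of z x y w] s23[of z x w y]
    by (simp add: q_closed)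
  also have "\<dots> = inv (q x y z w)"
    using assms by (simp add: pair inv_commutator)
  finally have "q x y z w = q x y z w \<otimes> q x y z w"
    using assms by (simp add: q_closed flip: inv_eq_square)
  then show ?thesis
    using assms q_closed[of x y z w] by (simp add: q_def)
qed

section \<open>The lower central series and class at most 3\<close>

lemma lower_central_2:
  "lower_central G 2 = generate G (\<Union>x\<in>carrier G. \<Union>y\<in>carrier G. {commutator G x y})"
  by (simp add: numeral_2_eq_2 commutator_subgroup_def commutator_def)

lemma lower_central_3:
  "lower_central G 3 = generate G (\<Union>c\<in>lower_central G 2. \<Union>y\<in>carrier G. {commutator G c y})"
  by (simp add: numeral_2_eq_2 numeral_3_eq_3 commutator_subgroup_def commutator_def)

lemma lower_central_2_subgroup: "subgroup (lower_central G 2) G"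
  unfolding lower_central_2 by (rule generate_is_subgroup) auto

lemma lower_central_2_carrier [simp]: "c \<in> lower_central G 2 \<Longrightarrow> c \<in> carrier G"
  by (rule subgroup.mem_carrier[OF lower_central_2_subgroup])

lemma lower_central_3_subgroup: "subgroup (lower_central G 3) G"
  unfolding lower_central_3 by (rule generate_is_subgroup) auto

lemma lower_central_3_carrier [simp]: "c \<in> lower_central G 3 \<Longrightarrow> c \<in> carrier G"
  by (rule subgroup.mem_carrier[OF lower_central_3_subgroup])

lemma commutator_in_lower_central_2 [simp]:
  "\<lbrakk>x \<in> carrier G; y \<in> carrier G\<rbrakk> \<Longrightarrow> commutator G x y \<in> lower_central G 2"
  unfolding lower_central_2 by (rule generate.incl) blast

lemma commutator_in_lower_central_3 [simp]:
  "\<lbrakk>c \<in> lower_central G 2; y \<in> carrier G\<rbrakk> \<Longrightarrow> commutator G c y \<in> lower_central G 3"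
  unfolding lower_central_3 by (rule generate.incl) blast

lemma lower_central_3_subset: "lower_central G 3 \<subseteq> lower_central G 2"
  unfolding lower_central_3
proof (rule generate_subgroup_incl[OF _ lower_central_2_subgroup])
  show "(\<Union>c\<in>lower_central G 2. \<Union>y\<in>carrier G. {commutator G c y}) \<subseteq> lower_central G 2"
    by (blast intro: commutator_in_lower_central_2 lower_central_2_carrier)
qed

lemma commutator_mult_left:
  "\<lbrakk>x \<in> carrier G; y \<in> carrier G; z \<in> carrier G\<rbrakk>
    \<Longrightarrow> commutator G (x \<otimes> y) z = conj x (commutator G y z) \<otimes> commutator G x z"
  by (simp add: commutator_def conj_def m_assoc inv_mult_group)

definition center :: "'a set" where "center = {z \<in> carrier G. \<forall>w\<in>carrier G. z \<otimes> w = w \<otimes> z}"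

lemma centerI:
  "\<lbrakk>z \<in> carrier G; \<And>w. w \<in> carrier G \<Longrightarrow> z \<otimes> w = w \<otimes> z\<rbrakk> \<Longrightarrow> z \<in> center"
  unfolding center_def by blast

lemma center_subgroup: "subgroup center G"
  unfolding center_def by (rule centralizer_subgroup) simp

lemma center_commute: "\<lbrakk>z \<in> center; w \<in> carrier G\<rbrakk> \<Longrightarrow> z \<otimes> w = w \<otimes> z"
  by (simp add: center_def)

text \<open>\<open>commutator4_trivial\<close> covers only \<open>c = [x, y]\<close>, whereas
  \<open>\<gamma>\<^sub>2\<close> contains products of these. The elements with only central
  commutators form a subgroup, since \<open>[a b, z] = [b, z] [a, z]\<close> as soon as
  \<open>[b, z]\<close> is central.\<close>

lemma commutator_lower_central_2_center:
  assumes "c \<in> lower_central G 2" "z \<in> carrier G"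
  shows "commutator G c z \<in> center"
proof -
  let ?Z = "{c \<in> carrier G. \<forall>z\<in>carrier G. commutator G c z \<in> center}"
  interpret center: subgroup center G by (rule center_subgroup)
  have "subgroup ?Z G"
  proof (rule subgroupI)
    have "\<one> \<in> ?Z" by (simp add: commutator_def)
    then show "?Z \<noteq> {}" by blast
  next
    fix a assume "a \<in> ?Z"
    then show "inv a \<in> ?Z" by (simp add: commutator_inv_left)
  next
    fix a b assume ab: "a \<in> ?Z" "b \<in> ?Z"
    have "commutator G (a \<otimes> b) z \<in> center" if z: "z \<in> carrier G" for z
    proof -
      have G: "a \<in> carrier G" "b \<in> carrier G" and C: "commutator G a z \<in> center" "commutator G b z \<in> center"
        using ab z by auto
      have "commutator G (a \<otimes> b) z = a \<otimes> commutator G b z \<otimes> inv a \<otimes> commutator G a z"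
        using G z by (simp add: commutator_mult_left conj_def)
      also have "a \<otimes> commutator G b z = commutator G b z \<otimes> a"
        using center_commute[OF C(2) G(1)] by simp
      finally have "commutator G (a \<otimes> b) z = commutator G b z \<otimes> commutator G a z"
        using G z by (simp add: m_assoc)
      then show ?thesis using C by simp
    qed
    then show "a \<otimes> b \<in> ?Z" using ab by simp
  qed auto
  moreover have "commutator G x y \<in> ?Z" if xy: "x \<in> carrier G" "y \<in> carrier G" for x y
  proof -
    have "commutator G (commutator G x y) z \<in> center" if "z \<in> carrier G" for z
      using that xy
      by (intro centerI commutator_eq_one_iff[THEN iffD1] commutator4_trivial commutator_closed)
    then show ?thesis using xy by simp
  qed
  ultimately have "lower_central G 2 \<subseteq> ?Z"
    unfolding lower_central_2 by (intro generate_subgroup_incl) blast+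
  then show ?thesis using assms by blast
qed

lemma lower_central_3_center: "lower_central G 3 \<subseteq> center"
  unfolding lower_central_3
  by (rule generate_subgroup_incl[OF _ center_subgroup]) (auto simp: commutator_lower_central_2_center)

lemma lower_central_3_commute: "\<lbrakk>c \<in> lower_central G 3; w \<in> carrier G\<rbrakk> \<Longrightarrow> c \<otimes> w = w \<otimes> c"
  using lower_central_3_center center_commute by blast

text \<open>For a generator, \<open>[[x, y], c]\<close> rotates to \<open>[[c, x], y]\<close>, which
  is trivial because \<open>[c, x]\<close> is central.\<close>

lemma lower_central_2_commute:
  assumes "c \<in> lower_central G 2" "d \<in> lower_central G 2"
  shows "c \<otimes> d = d \<otimes> c"
proof -
  have *: "commutator G x y \<otimes> c = c \<otimes> commutator G x y"
    if c: "c \<in> lower_central G 2" and xy: "x \<in> carrier G" "y \<in> carrier G" for c x y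
  proof -
    have "commutator G (commutator G x y) c = commutator G (commutator G c x) y"
      using commutator3_rotate[of c x y] c xy by simp
    also have "\<dots> = \<one>"
      using c xy center_commute[OF commutator_lower_central_2_center[OF c xy(1)] xy(2)]
      by (subst commutator_eq_one_iff) simp_all
    finally show ?thesis
      using c xy by (intro commutator_eq_one_iff[THEN iffD1]) simp_all
  qed
  show ?thesis
  proof (rule generate_commute[OF _ _ _ assms[unfolded lower_central_2]])
    fix s t
    assume "s \<in> (\<Union>x\<in>carrier G. \<Union>y\<in>carrier G. {commutator G x y})"
      and "t \<in> (\<Union>x\<in>carrier G. \<Union>y\<in>carrier G. {commutator G x y})"
    then show "s \<otimes> t = t \<otimes> s" by (blast intro: * commutator_in_lower_central_2)
  qed auto
qed

text \<open>The conjugate \<open>x [y, z] x^-1\<close> is \<open>[x, [y, z]] [y, z]\<close>, and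
  \<open>[x, [y, z]] = [[y, x], z]\<close>. Thus \<open>f = [_, z]\<close> satisfies
  \<open>f (x y) = f x f y f [y, x]\<close>, the form in which \<open>lie_homI_mult\<close>
  recognises Baer-linearity.\<close>

lemma commutator_product:
  assumes "x \<in> carrier G" "y \<in> carrier G" "z \<in> carrier G"
  shows "commutator G (x \<otimes> y) z
    = commutator G x z \<otimes> commutator G y z \<otimes> commutator G (commutator G y x) z"
proof -
  have "commutator G (x \<otimes> y) z = commutator G x (commutator G y z) \<otimes> commutator G y z \<otimes> commutator G x z"
  proof -
    have "conj x c = commutator G x c \<otimes> c" if "c \<in> carrier G" for c
      using that assms by (simp add: commutator_def conj_def m_assoc)
    then show ?thesis using assms by (simp add: commutator_mult_left)
  qed
  also have "commutator G x (commutator G y z) = commutator G (commutator G y x) z"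
    using assms commutator3_swap_right[of y x z] by (simp add: inv_commutator)
  also have "commutator G (commutator G y x) z \<otimes> commutator G y z \<otimes> commutator G x z
    = commutator G (commutator G y x) z \<otimes> (commutator G y z \<otimes> commutator G x z)"
    using assms by (simp add: m_assoc)
  also have "commutator G y z \<otimes> commutator G x z = commutator G x z \<otimes> commutator G y z"
    using assms by (intro lower_central_2_commute commutator_in_lower_central_2)
  also have "commutator G (commutator G y x) z \<otimes> (commutator G x z \<otimes> commutator G y z)
    = commutator G x z \<otimes> commutator G y z \<otimes> commutator G (commutator G y x) z"
    using assms by (intro lower_central_3_commute) simp_all
  finally show ?thesis .
qed

end

subsection \<open>Retractions of the Baer group\<close>

text \<open>Zorn's lemma gives a maximal \<open>W\<close> between \<open>W0\<close> and
  \<open>H\<close> that meets \<open>E\<close> trivially. If some \<open>h\<close> in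
  \<open>H\<close> were outside \<open>W E\<close>, then \<open>W {1, h, h^-1}\<close> would be
  larger and still meet \<open>E\<close> trivially. Prescribing \<open>W0\<close> allows a
  complement found in one subgroup to be extended to a bigger one.\<close>

lemma (in comm_group) exponent_3_complement:
  assumes cube: "\<And>x. x \<in> carrier G \<Longrightarrow> x \<otimes> (x \<otimes> x) = \<one>"
    and E: "subgroup E G" and H: "subgroup H G" and W0: "subgroup W0 G" "W0 \<subseteq> H" "W0 \<inter> E = {\<one>}"
  obtains W where "subgroup W G" "W0 \<subseteq> W" "W \<subseteq> H" "W \<inter> E = {\<one>}"
    "\<And>h. h \<in> H \<Longrightarrow> \<exists>w\<in>W. \<exists>e\<in>E. h = w \<otimes> e"
proof -
  let ?A = "{W. subgroup W G \<and> W0 \<subseteq> W \<and> W \<subseteq> H \<and> W \<inter> E = {\<one>}}"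
  have "\<exists>M\<in>?A. \<forall>X\<in>?A. M \<subseteq> X \<longrightarrow> X = M"
  proof (rule subset_Zorn_nonempty)
    show "?A \<noteq> {}" using W0 by blast
  next
    fix \<C> assume C: "\<C> \<noteq> {}" "subset.chain ?A \<C>"
    have mem: "X \<in> ?A" if "X \<in> \<C>" for X using C that unfolding subset.chain_def by blast
    have "subgroup (\<Union>\<C>) G"
    proof (rule subgroupI)
      show "\<Union>\<C> \<subseteq> carrier G" using mem subgroup.subset by fastforce
      show "\<Union>\<C> \<noteq> {}" using mem C(1) subgroup.one_closed by fastforce
    next
      fix a assume "a \<in> \<Union>\<C>"
      then obtain X where "X \<in> \<C>" "a \<in> X" by blast
      then show "inv a \<in> \<Union>\<C>" using mem[of X] subgroup.m_inv_closed[of X G a] by blast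
    next
      fix a b assume "a \<in> \<Union>\<C>" "b \<in> \<Union>\<C>"
      then obtain X Y where XY: "X \<in> \<C>" "a \<in> X" "Y \<in> \<C>" "b \<in> Y" by blast
      then have "X \<subseteq> Y \<or> Y \<subseteq> X" using C(2) unfolding subset.chain_def by blast
      then obtain Z where "Z \<in> \<C>" "a \<in> Z" "b \<in> Z" using XY by blast
      then show "a \<otimes> b \<in> \<Union>\<C>" using mem[of Z] subgroup.m_closed[of Z G a b] by blast
    qed
    moreover have "\<Union>\<C> \<inter> E = {\<one>}" using mem C(1) by blast
    moreover have "W0 \<subseteq> \<Union>\<C>" "\<Union>\<C> \<subseteq> H" using mem C(1) by blast+
    ultimately show "\<Union>\<C> \<in> ?A" by simp
  qed
  then obtain W where W: "subgroup W G" "W0 \<subseteq> W" "W \<subseteq> H" "W \<inter> E = {\<one>}"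
    and max: "\<And>X. \<lbrakk>subgroup X G; W0 \<subseteq> X; X \<subseteq> H; X \<inter> E = {\<one>}; W \<subseteq> X\<rbrakk> \<Longrightarrow> X = W"
    by auto
  interpret W: subgroup W G by (rule W(1))
  interpret E: subgroup E G by (rule E)
  interpret H: subgroup H G by (rule H)
  have "\<exists>w\<in>W. \<exists>e\<in>E. h = w \<otimes> e" if h: "h \<in> H" for h
  proof (rule ccontr)
    assume neg: "\<not> (\<exists>w\<in>W. \<exists>e\<in>E. h = w \<otimes> e)"
    let ?T = "{\<one>, h, inv h}"
    have hG: "h \<in> carrier G" using h by simp
    have hh: "h \<otimes> h = inv h" "inv h \<otimes> inv h = h"
      using hG cube[of h] cube[of "inv h"] inv_equality[of "h \<otimes> h" h] inv_equality[of "inv h \<otimes> inv h" "inv h"]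
      by (simp_all add: m_assoc)
    have T: "subgroup ?T G"
      by (rule subgroupI) (use hG hh in auto)
    have "W <#> ?T = W"
    proof (rule max)
      show "subgroup (W <#> ?T) G" by (rule mult_subgroups[OF W(1) T])
      show WT: "W \<subseteq> W <#> ?T" by (force simp: set_mult_def)
      then show "W0 \<subseteq> W <#> ?T" using W(2) by blast
      show "W <#> ?T \<subseteq> H" using W(3) h by (auto simp: set_mult_def)
      \<comment> \<open>A nontrivial \<open>t\<close> could be solved for \<open>h\<close> and would
        put \<open>h\<close> into \<open>W E\<close>.\<close>
      have "x = \<one>" if xW: "x \<in> W <#> ?T" and xE: "x \<in> E" for x
      proof -
        obtain w t where wt: "w \<in> W" "t \<in> ?T" "x = w \<otimes> t" using xW unfolding set_mult_def by blast
        have "t \<noteq> h"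
        proof
          assume "t = h"
          then have "h = inv w \<otimes> x" using wt hG by (simp flip: m_assoc)
          then show False using neg wt xE by blast
        qed
        moreover have "t \<noteq> inv h"
        proof
          assume "t = inv h"
          then have "inv x = inv w \<otimes> h" using wt hG by (simp add: inv_mult_group m_comm[of h])
          then have "h = w \<otimes> inv x" using wt(1) hG by (simp flip: m_assoc)
          then show False using neg wt xE by blast
        qed
        ultimately have "t = \<one>" using wt by blast
        then show ?thesis using wt xE W(4) by auto
      qed
      moreover have "\<one> \<in> W <#> ?T" using WT by auto
      ultimately show "(W <#> ?T) \<inter> E = {\<one>}" by auto
    qed
    moreover have "h \<in> W <#> ?T" using hG by (force simp: set_mult_def)
    ultimately have "h = h \<otimes> \<one>" "h \<in> W" using hG by simp_all
    then show False using neg E.one_closed by blast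
  qed
  then show thesis using W that by blast
qed

text \<open>First \<open>W1\<close> inside \<open>U\<close> is chosen with trivial intersection with
  \<open>E\<close> and with \<open>U\<close> contained in \<open>W1 E\<close>; then it is extended
  to a complement \<open>W\<close> of \<open>E\<close> in \<open>G\<close>, and
  \<open>\<rho>\<close> is the projection onto \<open>E\<close> along \<open>W\<close>. An element
  of \<open>U\<close> has its \<open>W\<close>-component in \<open>W1\<close>, hence in
  \<open>U\<close>, so its \<open>E\<close>-component lies in \<open>U\<close> too.\<close>

lemma (in comm_group) exponent_3_retraction:
  assumes cube: "\<And>x. x \<in> carrier G \<Longrightarrow> x \<otimes> (x \<otimes> x) = \<one>"
    and E: "subgroup E G" and U: "subgroup U G"
  obtains \<rho> where "\<rho> \<in> hom G G" "\<And>x. x \<in> carrier G \<Longrightarrow> \<rho> x \<in> E" "\<And>x. x \<in> E \<Longrightarrow> \<rho> x = x"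
    "\<And>x. x \<in> U \<Longrightarrow> \<rho> x \<in> U"
proof -
  interpret E: subgroup E G by (rule E)
  interpret U: subgroup U G by (rule U)
  have "{\<one>} \<inter> E = {\<one>}" "{\<one>} \<subseteq> U" by auto
  then obtain W1 where W1: "subgroup W1 G" "W1 \<subseteq> U" "W1 \<inter> E = {\<one>}"
    "\<And>h. h \<in> U \<Longrightarrow> \<exists>w\<in>W1. \<exists>e\<in>E. h = w \<otimes> e"
    using exponent_3_complement[OF cube E U triv_subgroup] by metis
  obtain W where W: "subgroup W G" "W1 \<subseteq> W" "W \<inter> E = {\<one>}"
    "\<And>h. h \<in> carrier G \<Longrightarrow> \<exists>w\<in>W. \<exists>e\<in>E. h = w \<otimes> e"
    using exponent_3_complement[OF cube E subgroup_self W1(1) subgroup.subset[OF W1(1)] W1(3)] by metis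
  interpret W: subgroup W G by (rule W(1))
  define \<rho> where "\<rho> x = (THE e. e \<in> E \<and> (\<exists>w\<in>W. x = w \<otimes> e))" for x
  have \<rho>: "\<rho> (w \<otimes> e) = e" if we: "w \<in> W" "e \<in> E" for w e
    unfolding \<rho>_def
  proof (rule the_equality)
    show "e \<in> E \<and> (\<exists>w'\<in>W. w \<otimes> e = w' \<otimes> e)" using we by blast
    fix e' assume "e' \<in> E \<and> (\<exists>w'\<in>W. w \<otimes> e = w' \<otimes> e')"
    then obtain w' where w': "e' \<in> E" "w' \<in> W" "w \<otimes> e = w' \<otimes> e'" by blast
    have "inv w' \<otimes> w = inv w' \<otimes> (w \<otimes> e) \<otimes> inv e"
      using we w'(2) by (simp add: m_assoc)
    also have "\<dots> = e' \<otimes> inv e"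
      using we w' by (simp add: m_assoc[symmetric])
    finally have "e' \<otimes> inv e \<in> W \<inter> E" using we w' by (metis E.m_closed E.m_inv_closed IntI W.m_closed W.m_inv_closed)
    then have "e' \<otimes> inv e = \<one>" using W(3) by blast
    then show "e' = e" using we w' by (metis E.mem_carrier inv_equality inv_inv inv_closed)
  qed
  show thesis
  proof (rule that[of \<rho>])
    show "\<rho> \<in> hom G G"
    proof (rule homI)
      fix x assume "x \<in> carrier G"
      then show "\<rho> x \<in> carrier G" using W(4)[of x] \<rho> by auto
    next
      fix x y assume "x \<in> carrier G" "y \<in> carrier G"
      then obtain w e w' e' where *: "w \<in> W" "e \<in> E" "x = w \<otimes> e" "w' \<in> W" "e' \<in> E" "y = w' \<otimes> e'"
        using W(4) by meson
      then have "x \<otimes> y = (w \<otimes> w') \<otimes> (e \<otimes> e')" by (simp add: m_ac)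
      then show "\<rho> (x \<otimes> y) = \<rho> x \<otimes> \<rho> y"
        using * \<rho>[of "w \<otimes> w'" "e \<otimes> e'"] by (simp add: \<rho>)
    qed
    show "\<rho> x \<in> E" if "x \<in> carrier G" for x using W(4)[OF that] \<rho> by auto
    show "\<rho> x = x" if "x \<in> E" for x using \<rho>[of \<one> x] that by simp
    show "\<rho> x \<in> U" if x: "x \<in> U" for x
    proof -
      obtain w e where *: "w \<in> W1" "e \<in> E" "x = w \<otimes> e" using W1(4)[OF x] by blast
      then have "w \<in> W" "w \<in> U" using W1 W by blast+
      then have "e = inv w \<otimes> x" using * by (simp flip: m_assoc)
      then have "e \<in> U" using \<open>w \<in> U\<close> x by simp
      then show ?thesis using \<rho> * \<open>w \<in> W\<close> by simp
    qed
  qed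
qed

text \<open>Baer's trick: \<open>-1/2 = 1\<close> modulo 3, so this is the addition of the Lie ring attached to a group of
  exponent 3 and class 2. On a group of class 3 it is an abelian group law only modulo \<open>\<gamma>\<^sub>3\<close>.\<close>

definition baer_mult :: "('a, 'c) monoid_scheme \<Rightarrow> 'a \<Rightarrow> 'a \<Rightarrow> 'a" where
  "baer_mult G x y = x \<otimes>\<^bsub>G\<^esub> y \<otimes>\<^bsub>G\<^esub> commutator G x y"

definition baer_group :: "('a, 'c) monoid_scheme \<Rightarrow> 'a monoid" where
  "baer_group G = \<lparr>carrier = carrier G, monoid.mult = baer_mult G, one = \<one>\<^bsub>G\<^esub>\<rparr>"

lemma baer_group_simps [simp]:
  "carrier (baer_group G) = carrier G" "mult (baer_group G) = baer_mult G" "\<one>\<^bsub>baer_group G\<^esub> = \<one>\<^bsub>G\<^esub>"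
  by (simp_all add: baer_group_def)

lemma (in group_hom) hom_commutator:
  "\<lbrakk>x \<in> carrier G; y \<in> carrier G\<rbrakk> \<Longrightarrow> h (commutator G x y) = commutator H (h x) (h y)"
  by (simp add: commutator_def)

lemma (in group) commutator_self [simp]:
  "x \<in> carrier G \<Longrightarrow> commutator G x x = \<one>"
  "x \<in> carrier G \<Longrightarrow> commutator G (inv x) x = \<one>"
  "x \<in> carrier G \<Longrightarrow> commutator G x \<one> = \<one>"
  "x \<in> carrier G \<Longrightarrow> commutator G \<one> x = \<one>"
  by (simp_all add: commutator_eq_one_iff)

context V3_group begin

lemma baer_mult_closed [simp]:
  "\<lbrakk>x \<in> carrier G; y \<in> carrier G\<rbrakk> \<Longrightarrow> baer_mult G x y \<in> carrier G"
  by (simp add: baer_mult_def)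

lemma subgroup_commutator:
  "\<lbrakk>subgroup D G; x \<in> D; y \<in> D\<rbrakk> \<Longrightarrow> commutator G x y \<in> D"
  by (simp add: commutator_def subgroup.m_closed subgroup.m_inv_closed)

lemma subgroup_baer_mult:
  "\<lbrakk>subgroup D G; x \<in> D; y \<in> D\<rbrakk> \<Longrightarrow> baer_mult G x y \<in> D"
  by (simp add: baer_mult_def subgroup.m_closed subgroup_commutator)

text \<open>In class 2 the commutator is multiplicative in each argument, which gives associativity.
  Commutativity is where exponent 3 enters: \<open>x y [x, y] = y x [x, y]^2\<close> and
  \<open>[x, y]^2 = [y, x]\<close>. Inverses are those of \<open>G\<close>, so subgroups of
  \<open>G\<close> remain subgroups.\<close>

lemma baer_group_class_2:
  assumes class2: "\<And>x y. \<lbrakk>x \<in> carrier G; y \<in> carrier G\<rbrakk> \<Longrightarrow> commutator G x y \<in> center"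
  shows "comm_group (baer_group G)"
    and "x \<in> carrier G \<Longrightarrow> baer_mult G x (baer_mult G x x) = \<one>"
    and "subgroup D G \<Longrightarrow> subgroup D (baer_group G)"
proof -
  have central: "commutator G x y \<otimes> z = z \<otimes> commutator G x y"
    if "x \<in> carrier G" "y \<in> carrier G" "z \<in> carrier G" for x y z
    using that by (intro center_commute class2)
  have central_one: "commutator G (commutator G x y) z = \<one>"
    if "x \<in> carrier G" "y \<in> carrier G" "z \<in> carrier G" for x y z
    using that by (intro commutator_eq_one_iff[THEN iffD2] central commutator_closed)
  have left: "commutator G (x \<otimes> y) z = commutator G x z \<otimes> commutator G y z"
    if "x \<in> carrier G" "y \<in> carrier G" "z \<in> carrier G" for x y z
    using that by (simp add: commutator_product central_one)
  have right: "commutator G z (x \<otimes> y) = commutator G z x \<otimes> commutator G z y"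
    if xyz: "x \<in> carrier G" "y \<in> carrier G" "z \<in> carrier G" for x y z
  proof -
    have "commutator G z (x \<otimes> y) = inv (commutator G (x \<otimes> y) z)"
      using xyz by (simp add: inv_commutator)
    also have "\<dots> = commutator G z y \<otimes> commutator G z x"
      using xyz by (simp add: left inv_mult_group inv_commutator)
    also have "\<dots> = commutator G z x \<otimes> commutator G z y"
      using xyz by (intro central commutator_closed)
    finally show ?thesis .
  qed
  have central_one': "commutator G z (commutator G x y) = \<one>"
    if "x \<in> carrier G" "y \<in> carrier G" "z \<in> carrier G" for x y z
    using that central_one[of x y z] inv_commutator[of "commutator G x y" z] by simp
  have assoc: "baer_mult G (baer_mult G x y) z = baer_mult G x (baer_mult G y z)"
    if xyz: "x \<in> carrier G" "y \<in> carrier G" "z \<in> carrier G" for x y z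
  proof -
    let ?a = "commutator G x y" and ?b = "commutator G x z" and ?c = "commutator G y z"
    have "baer_mult G (baer_mult G x y) z = x \<otimes> (y \<otimes> ((?a \<otimes> z) \<otimes> (?b \<otimes> ?c)))"
      using xyz by (simp add: baer_mult_def left central_one m_assoc)
    also have "\<dots> = x \<otimes> (y \<otimes> (z \<otimes> (?a \<otimes> (?b \<otimes> ?c))))"
      using xyz by (subst central) (simp_all add: m_assoc)
    also have "?a \<otimes> (?b \<otimes> ?c) = (?a \<otimes> ?b) \<otimes> ?c"
      using xyz by (simp add: m_assoc)
    also have "\<dots> = ?c \<otimes> (?a \<otimes> ?b)"
      using xyz by (intro central[symmetric]) simp_all
    also have "x \<otimes> (y \<otimes> (z \<otimes> (?c \<otimes> (?a \<otimes> ?b)))) = baer_mult G x (baer_mult G y z)"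
      using xyz by (simp add: baer_mult_def right central_one' m_assoc)
    finally show ?thesis .
  qed
  have comm: "baer_mult G x y = baer_mult G y x" if xy: "x \<in> carrier G" "y \<in> carrier G" for x y
  proof -
    let ?a = "commutator G x y"
    have "x \<otimes> y = ?a \<otimes> (y \<otimes> x)" using xy by (simp add: commutator_def m_assoc)
    also have "\<dots> = (y \<otimes> x) \<otimes> ?a" using xy by (intro central) simp_all
    finally have "baer_mult G x y = (y \<otimes> x) \<otimes> (?a \<otimes> ?a)"
      using xy by (simp add: baer_mult_def m_assoc)
    also have "?a \<otimes> ?a = commutator G y x"
      using xy inv_eq_square[of ?a] by (simp add: inv_commutator)
    finally show ?thesis by (simp add: baer_mult_def)
  qed
  have linv: "baer_mult G (inv x) x = \<one>" if "x \<in> carrier G" for x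
    using that by (simp add: baer_mult_def)
  have group: "group (baer_group G)"
  proof (rule groupI)
    fix x assume "x \<in> carrier (baer_group G)"
    then show "\<exists>y\<in>carrier (baer_group G). y \<otimes>\<^bsub>baer_group G\<^esub> x = \<one>\<^bsub>baer_group G\<^esub>"
      by (intro bexI[of _ "inv x"]) (simp_all add: linv)
  qed (simp_all add: assoc, simp add: baer_mult_def)
  show grp: "comm_group (baer_group G)"
    by (rule group.group_comm_groupI[OF group]) (simp add: comm)
  show "baer_mult G x (baer_mult G x x) = \<one>" if "x \<in> carrier G"
    using that cube[OF that] by (simp add: baer_mult_def right)
  show "subgroup D (baer_group G)" if D: "subgroup D G"
  proof (rule group.subgroupI[OF group])
    show "D \<subseteq> carrier (baer_group G)" using subgroup.subset[OF D] by simp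
    show "D \<noteq> {}" using subgroup.one_closed[OF D] by blast
    show "a \<otimes>\<^bsub>baer_group G\<^esub> b \<in> D" if "a \<in> D" "b \<in> D" for a b
      using subgroup_baer_mult[OF D that] by simp
    show "inv\<^bsub>baer_group G\<^esub> a \<in> D" if "a \<in> D" for a
    proof -
      have "a \<in> carrier G" using subgroup.mem_carrier[OF D that] .
      then have "inv\<^bsub>baer_group G\<^esub> a = inv a"
        by (intro group.inv_equality[OF group]) (simp_all add: linv)
      then show ?thesis using subgroup.m_inv_closed[OF D that] by simp
    qed
  qed
qed

end

text \<open>A linear retraction of the Baer group of \<open>G\<close> modulo
  \<open>\<gamma>\<^sub>3\<close> onto the image of \<open>D\<close>, written with representatives.
  Additivity therefore holds only up to a factor in \<open>\<gamma>\<^sub>3\<close>, while the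
  elements of \<open>D\<close> themselves are fixed.\<close>

definition lie_retraction :: "('a, 'c) monoid_scheme \<Rightarrow> 'a set \<Rightarrow> ('a \<Rightarrow> 'a) \<Rightarrow> bool" where
  "lie_retraction G D r \<longleftrightarrow> r \<in> carrier G \<rightarrow> D \<and> (\<forall>d\<in>D. r d = d) \<and>
    r ` lower_central G 2 \<subseteq> lower_central G 2 \<and> r ` lower_central G 3 \<subseteq> lower_central G 3 \<and>
    (\<forall>x\<in>carrier G. \<forall>y\<in>carrier G. \<exists>z\<in>lower_central G 3.
      r (baer_mult G x y) = baer_mult G (r x) (r y) \<otimes>\<^bsub>G\<^esub> z)"

context V3_group begin

lemma lower_central_3_normal: "lower_central G 3 \<lhd> G"
proof (rule normal_invI[OF lower_central_3_subgroup])
  fix x h assume xh: "x \<in> carrier G" "h \<in> lower_central G 3"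
  then have "x \<otimes> h = h \<otimes> x" by (intro lower_central_3_commute[symmetric])
  then have "x \<otimes> h \<otimes> inv x = h" using xh by (simp add: m_assoc)
  then show "x \<otimes> h \<otimes> inv x \<in> lower_central G 3" using xh by simp
qed

text \<open>The quotient \<open>Q\<close> by \<open>\<gamma>\<^sub>3\<close> has class at most 2, so
  its Baer group is abelian of exponent 3 and \<open>exponent_3_retraction\<close> applies, with the
  images of \<open>D\<close> and \<open>\<gamma>\<^sub>2\<close> as \<open>E\<close> and
  \<open>U\<close>.\<close>

lemma lie_retraction_exists:
  assumes D: "subgroup D G"
  obtains r where "lie_retraction G D r"
proof -
  interpret N: normal "lower_central G 3" G by (rule lower_central_3_normal)
  define Q where "Q = G Mod lower_central G 3"
  define p where "p x = lower_central G 3 #> x" for x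
  have Q_group: "group Q" unfolding Q_def by (rule N.factorgroup_is_group)
  have p_hom: "p \<in> hom G Q" unfolding Q_def p_def using N.r_coset_hom_Mod .
  have p_surj: "p ` carrier G = carrier Q"
    by (auto simp: p_def Q_def carrier_FactGroup)
  interpret p: group_hom G Q p
    using Q_group p_hom by (simp add: group_hom_def group_hom_axioms_def)
  have repr: "\<exists>x\<in>carrier G. X = p x" if "X \<in> carrier Q" for X
    using that p_surj by blast
  have p_eqD: "\<exists>z\<in>lower_central G 3. u = v \<otimes> z"
    if uv: "u \<in> carrier G" "v \<in> carrier G" "p u = p v" for u v
  proof -
    have "u \<in> lower_central G 3 #> v"
      using rcos_self[OF uv(1) N.is_subgroup] uv(3) unfolding p_def by simp
    then obtain z where z: "z \<in> lower_central G 3" "u = z \<otimes> v"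
      unfolding r_coset_def by blast
    then show ?thesis using lower_central_3_commute[OF z(1) uv(2)] by blast
  qed
  have p_one: "p z = \<one>\<^bsub>Q\<^esub>" if "z \<in> lower_central G 3" for z
    using coset_join2[OF _ N.is_subgroup that] that by (simp add: p_def Q_def)
  interpret Q: V3_group Q
  proof (intro V3_group.intro V3_group_axioms.intro Q_group)
    fix X assume "X \<in> carrier Q"
    then obtain x where "x \<in> carrier G" "X = p x" using repr by blast
    then show "X \<otimes>\<^bsub>Q\<^esub> (X \<otimes>\<^bsub>Q\<^esub> X) = \<one>\<^bsub>Q\<^esub>"
      using cube[of x] by (simp flip: p.hom_mult)
  qed
  have class2: "commutator Q X Y \<in> Q.center" if XY: "X \<in> carrier Q" "Y \<in> carrier Q" for X Y
  proof (rule Q.centerI)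
    show "commutator Q X Y \<in> carrier Q" using XY by simp
    fix Z assume Z: "Z \<in> carrier Q"
    obtain x y z where xyz: "x \<in> carrier G" "X = p x" "y \<in> carrier G" "Y = p y" "z \<in> carrier G" "Z = p z"
      using repr XY Z by meson
    have "commutator Q (commutator Q X Y) Z = p (commutator G (commutator G x y) z)"
      using xyz by (simp add: p.hom_commutator)
    also have "\<dots> = \<one>\<^bsub>Q\<^esub>" using xyz by (simp add: p_one)
    finally show "commutator Q X Y \<otimes>\<^bsub>Q\<^esub> Z = Z \<otimes>\<^bsub>Q\<^esub> commutator Q X Y"
      using XY Z by (intro group.commutator_eq_one_iff[OF Q_group, THEN iffD1]) simp_all
  qed
  interpret L: comm_group "baer_group Q" by (rule Q.baer_group_class_2(1)[OF class2])
  have image: "subgroup (p ` S) (baer_group Q)" if "subgroup S G" for S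
    by (rule Q.baer_group_class_2(3)[OF class2 p.subgroup_img_is_subgroup[OF that]])
  obtain \<rho> where \<rho>: "\<rho> \<in> hom (baer_group Q) (baer_group Q)" "\<And>X. X \<in> carrier Q \<Longrightarrow> \<rho> X \<in> p ` D"
    "\<And>X. X \<in> p ` D \<Longrightarrow> \<rho> X = X" "\<And>X. X \<in> p ` lower_central G 2 \<Longrightarrow> \<rho> X \<in> p ` lower_central G 2"
    using L.exponent_3_retraction[OF _ image[OF D] image[OF lower_central_2_subgroup]]
      Q.baer_group_class_2(2)[OF class2] by auto
  \<comment> \<open>A representative in \<open>D\<close> of the retracted coset. On \<open>D\<close>
    it is set to the element itself, since an arbitrary choice would fix it only modulo
    \<open>\<gamma>\<^sub>3\<close>.\<close>
  define r where "r x = (if x \<in> D then x else SOME d. d \<in> D \<and> p d = \<rho> (p x))" for x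
  have r: "r x \<in> D" "p (r x) = \<rho> (p x)" if x: "x \<in> carrier G" for x
  proof -
    have "\<exists>d. d \<in> D \<and> p d = \<rho> (p x)" using \<rho>(2)[of "p x"] x by auto
    from someI_ex[OF this] show "r x \<in> D" "p (r x) = \<rho> (p x)"
      using \<rho>(3)[of "p x"] by (auto simp: r_def)
  qed
  have rG: "r x \<in> carrier G" if "x \<in> carrier G" for x
    using r(1)[OF that] subgroup.mem_carrier[OF D] by blast
  have p_baer: "p (baer_mult G x y) = baer_mult Q (p x) (p y)" if "x \<in> carrier G" "y \<in> carrier G" for x y
    using that by (simp add: baer_mult_def p.hom_commutator)
  show thesis
  proof (rule that, unfold lie_retraction_def, intro conjI ballI)
    show "r \<in> carrier G \<rightarrow> D" using r(1) by blast
    show "r d = d" if "d \<in> D" for d using that by (simp add: r_def)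
    show "r ` lower_central G 2 \<subseteq> lower_central G 2"
    proof (rule image_subsetI)
      fix c assume c: "c \<in> lower_central G 2"
      then have "p (r c) \<in> p ` lower_central G 2" using r(2)[of c] \<rho>(4)[of "p c"] by simp
      then obtain c' where c': "c' \<in> lower_central G 2" "p (r c) = p c'" by blast
      then obtain z where z: "z \<in> lower_central G 3" "r c = c' \<otimes> z"
        using p_eqD[of "r c" c'] c rG[of c] by auto
      then have "z \<in> lower_central G 2" using lower_central_3_subset by blast
      then show "r c \<in> lower_central G 2"
        using z c' subgroup.m_closed[OF lower_central_2_subgroup] by simp
    qed
    show "r ` lower_central G 3 \<subseteq> lower_central G 3"
    proof (rule image_subsetI)
      fix c assume c: "c \<in> lower_central G 3"
      have "p \<one> \<in> p ` D" using subgroup.one_closed[OF D] by blast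
      then have "p (r c) = p \<one>" using c r(2)[of c] \<rho>(3)[of "p \<one>"] by (simp add: p_one)
      then obtain z where "z \<in> lower_central G 3" "r c = \<one> \<otimes> z"
        using p_eqD[of "r c" \<one>] c rG[of c] by auto
      then show "r c \<in> lower_central G 3" by simp
    qed
    show "\<exists>z\<in>lower_central G 3. r (baer_mult G x y) = baer_mult G (r x) (r y) \<otimes> z"
      if xy: "x \<in> carrier G" "y \<in> carrier G" for x y
    proof (rule p_eqD)
      show "p (r (baer_mult G x y)) = p (baer_mult G (r x) (r y))"
        using xy hom_mult[OF \<rho>(1), of "p x" "p y"] by (simp add: r(2) p_baer rG)
    qed (use xy rG in auto)
  qed
qed

end

subsection \<open>Baer-linear maps and the twisted product\<close>

text \<open>Even for a proper subgroup \<open>D\<close>, the term \<open>\<gamma>\<^sub>3\<close> is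
  that of the ambient \<open>G\<close>. This lets \<open>f\<close> absorb the error of a
  \<open>lie_retraction\<close> onto \<open>D\<close>, which is controlled only in
  \<open>G\<close>.\<close>

definition lie_hom ::
  "('a, 'c) monoid_scheme \<Rightarrow> 'a set \<Rightarrow> ('b, 'd) monoid_scheme \<Rightarrow> ('a \<Rightarrow> 'b) \<Rightarrow> bool" where
  "lie_hom G D A f \<longleftrightarrow> f \<in> D \<rightarrow> carrier A \<and>
    (\<forall>x\<in>D. \<forall>y\<in>D. f (baer_mult G x y) = f x \<otimes>\<^bsub>A\<^esub> f y) \<and>
    (\<forall>z\<in>D \<inter> lower_central G 3. f z = \<one>\<^bsub>A\<^esub>)"

lemma lie_homD:
  assumes "lie_hom G D A f"
  shows "x \<in> D \<Longrightarrow> f x \<in> carrier A"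
    and "\<lbrakk>x \<in> D; y \<in> D\<rbrakk> \<Longrightarrow> f (baer_mult G x y) = f x \<otimes>\<^bsub>A\<^esub> f y"
    and "\<lbrakk>z \<in> D; z \<in> lower_central G 3\<rbrakk> \<Longrightarrow> f z = \<one>\<^bsub>A\<^esub>"
  using assms by (simp_all add: lie_hom_def Pi_iff)

lemma lie_homI:
  assumes "\<And>x. x \<in> D \<Longrightarrow> f x \<in> carrier A"
    and "\<And>x y. \<lbrakk>x \<in> D; y \<in> D\<rbrakk> \<Longrightarrow> f (baer_mult G x y) = f x \<otimes>\<^bsub>A\<^esub> f y"
    and "\<And>z. \<lbrakk>z \<in> D; z \<in> lower_central G 3\<rbrakk> \<Longrightarrow> f z = \<one>\<^bsub>A\<^esub>"
  shows "lie_hom G D A f"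
  using assms by (simp add: lie_hom_def Pi_iff)

lemma lie_retractionD:
  assumes "lie_retraction G D r"
  shows "x \<in> carrier G \<Longrightarrow> r x \<in> D" and "d \<in> D \<Longrightarrow> r d = d"
    and "c \<in> lower_central G 2 \<Longrightarrow> r c \<in> lower_central G 2"
    and "c \<in> lower_central G 3 \<Longrightarrow> r c \<in> lower_central G 3"
    and "\<lbrakk>x \<in> carrier G; y \<in> carrier G\<rbrakk> \<Longrightarrow> \<exists>z\<in>lower_central G 3.
      r (baer_mult G x y) = baer_mult G (r x) (r y) \<otimes>\<^bsub>G\<^esub> z"
  using assms by (simp_all add: lie_retraction_def Pi_iff image_subset_iff)

context V3_group begin

text \<open>\<open>z\<close> is central, so \<open>u z\<close> is the Baer sum of \<open>u\<close>
  and \<open>z\<close>.\<close>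

lemma lie_hom_absorb:
  assumes D: "subgroup D G" and A: "group A" and f: "lie_hom G D A f"
    and uz: "u \<in> D" "z \<in> D" "z \<in> lower_central G 3"
  shows "f (u \<otimes> z) = f u"
proof -
  interpret A: group A by fact
  have G: "u \<in> carrier G" "z \<in> carrier G" using subgroup.mem_carrier[OF D] uz by blast+
  have "commutator G u z = \<one>"
    using lower_central_3_commute[OF uz(3) G(1)] G by (intro commutator_eq_one_iff[THEN iffD2]) simp_all
  then have "f (u \<otimes> z) = f (baer_mult G u z)" using G by (simp add: baer_mult_def)
  also have "\<dots> = f u"
    using uz by (simp add: lie_homD(2,3)[OF f] lie_homD(1)[OF f])
  finally show ?thesis .
qed

lemma lie_hom_retraction:
  assumes D: "subgroup D G" and A: "group A" and f: "lie_hom G D A f" and r: "lie_retraction G D r"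
  shows "lie_hom G (carrier G) A (\<lambda>x. f (r x))"
proof (rule lie_homI)
  note rD = lie_retractionD(1)[OF r]
  show "f (r x) \<in> carrier A" if "x \<in> carrier G" for x
    by (rule lie_homD(1)[OF f rD[OF that]])
  show "f (r z) = \<one>\<^bsub>A\<^esub>" if "z \<in> carrier G" "z \<in> lower_central G 3" for z
    by (rule lie_homD(3)[OF f rD[OF that(1)] lie_retractionD(4)[OF r that(2)]])
  fix x y assume xy: "x \<in> carrier G" "y \<in> carrier G"
  obtain z where z: "z \<in> lower_central G 3" "r (baer_mult G x y) = baer_mult G (r x) (r y) \<otimes> z"
    using lie_retractionD(5)[OF r xy] ..
  let ?u = "baer_mult G (r x) (r y)"
  have u: "?u \<in> D" by (rule subgroup_baer_mult[OF D rD rD]) (use xy in auto)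
  then have "?u \<in> carrier G" by (rule subgroup.mem_carrier[OF D])
  \<comment> \<open>The error \<open>z\<close> comes from \<open>\<gamma>\<^sub>3\<close> of
    \<open>G\<close>; being a quotient of elements of \<open>D\<close> it also lies in
    \<open>D\<close>, where \<open>f\<close> absorbs it.\<close>
  then have "z = inv ?u \<otimes> r (baer_mult G x y)" using z by simp
  also have "\<dots> \<in> D" using xy by (intro subgroup.m_closed[OF D] subgroup.m_inv_closed[OF D] u rD) simp
  finally have "f (r (baer_mult G x y)) = f ?u"
    using lie_hom_absorb[OF D A f u _ z(1)] z(2) by simp
  also have "\<dots> = f (r x) \<otimes>\<^bsub>A\<^esub> f (r y)" by (intro lie_homD(2)[OF f] rD xy)
  finally show "f (r (baer_mult G x y)) = f (r x) \<otimes>\<^bsub>A\<^esub> f (r y)" .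
qed

lemma lie_hom_closed: "\<lbrakk>lie_hom G (carrier G) A f; x \<in> carrier G\<rbrakk> \<Longrightarrow> f x \<in> carrier A"
  by (rule lie_homD(1))

lemma lie_hom_one: "lie_hom G (carrier G) A f \<Longrightarrow> f \<one> = \<one>\<^bsub>A\<^esub>"
  using subgroup.one_closed[OF lower_central_3_subgroup] by (intro lie_homD(3)[of G "carrier G" A f]) simp_all

text \<open>Modulo \<open>\<gamma>\<^sub>3\<close>, the product \<open>x y\<close> is the Baer sum
  of \<open>baer_mult G x y\<close> and \<open>[y, x]\<close>. The discrepancy is the commutator of
  these two and is absorbed.\<close>

lemma lie_hom_mult:
  assumes A: "group A" and f: "lie_hom G (carrier G) A f"
    and xy: "x \<in> carrier G" "y \<in> carrier G"
  shows "f (x \<otimes> y) = f x \<otimes>\<^bsub>A\<^esub> f y \<otimes>\<^bsub>A\<^esub> f (commutator G y x)"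
proof -
  let ?u = "baer_mult G x y" and ?c = "commutator G y x"
  have w: "commutator G ?u ?c \<in> lower_central G 3"
    using xy commutator_in_lower_central_3[of ?c ?u]
      subgroup.m_inv_closed[OF lower_central_3_subgroup, of "commutator G ?c ?u"]
    by (simp add: inv_commutator)
  have "?u \<otimes> ?c = x \<otimes> y \<otimes> (commutator G x y \<otimes> inv (commutator G x y))"
    using xy by (simp add: baer_mult_def m_assoc inv_commutator del: r_inv)
  then have "baer_mult G ?u ?c = x \<otimes> y \<otimes> commutator G ?u ?c"
    using xy by (simp add: baer_mult_def[of G ?u])
  then have "f (x \<otimes> y) = f (baer_mult G ?u ?c)"
    using lie_hom_absorb[OF subgroup_self A f, of "x \<otimes> y" "commutator G ?u ?c"] w xy by simp
  also have "\<dots> = f ?u \<otimes>\<^bsub>A\<^esub> f ?c" using xy by (intro lie_homD(2)[OF f]) simp_all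
  also have "f ?u = f x \<otimes>\<^bsub>A\<^esub> f y" using xy by (intro lie_homD(2)[OF f]) simp_all
  finally show ?thesis .
qed

text \<open>Converse of \<open>lie_hom_mult\<close>. Expanding \<open>f\<close> on
  \<open>x y [x, y]\<close> leaves the extra factors \<open>f [y, x]\<close> and
  \<open>f [x, y]\<close>, and these cancel because \<open>[x, y] [y, x] = 1\<close>.\<close>

lemma lie_homI_mult:
  assumes A: "comm_group A" and closed: "\<And>x. x \<in> carrier G \<Longrightarrow> f x \<in> carrier A"
    and mult: "\<And>x y. \<lbrakk>x \<in> carrier G; y \<in> carrier G\<rbrakk>
      \<Longrightarrow> f (x \<otimes> y) = f x \<otimes>\<^bsub>A\<^esub> f y \<otimes>\<^bsub>A\<^esub> f (commutator G y x)"
    and trivial: "\<And>z. z \<in> lower_central G 3 \<Longrightarrow> f z = \<one>\<^bsub>A\<^esub>"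
  shows "lie_hom G (carrier G) A f"
proof -
  interpret A: comm_group A by fact
  have "f (baer_mult G x y) = f x \<otimes>\<^bsub>A\<^esub> f y" if xy: "x \<in> carrier G" "y \<in> carrier G" for x y
  proof -
    let ?c = "commutator G x y" and ?d = "commutator G y x"
    have "f (?c \<otimes> ?d) = f ?c \<otimes>\<^bsub>A\<^esub> f ?d \<otimes>\<^bsub>A\<^esub> f (commutator G ?d ?c)"
      using xy by (intro mult) simp_all
    moreover have "?c \<otimes> ?d = \<one>" using xy r_inv[of ?c] by (simp add: inv_commutator del: r_inv)
    moreover have "f \<one> = \<one>\<^bsub>A\<^esub>" by (rule trivial[OF subgroup.one_closed[OF lower_central_3_subgroup]])
    ultimately have cd: "f ?c \<otimes>\<^bsub>A\<^esub> f ?d = \<one>\<^bsub>A\<^esub>"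
      using xy trivial[of "commutator G ?d ?c"] closed by simp
    have "f (baer_mult G x y) = f (x \<otimes> y) \<otimes>\<^bsub>A\<^esub> f ?c \<otimes>\<^bsub>A\<^esub> f (commutator G ?c (x \<otimes> y))"
      unfolding baer_mult_def using xy by (intro mult) simp_all
    also have "\<dots> = f x \<otimes>\<^bsub>A\<^esub> f y \<otimes>\<^bsub>A\<^esub> (f ?c \<otimes>\<^bsub>A\<^esub> f ?d)"
      using xy closed trivial[of "commutator G ?c (x \<otimes> y)"] mult[OF xy]
      by (simp add: A.m_ac)
    finally show ?thesis using cd closed xy by simp
  qed
  then show ?thesis by (intro lie_homI closed trivial)
qed

lemma lie_hom_diff:
  assumes A: "comm_group A" and f: "lie_hom G (carrier G) A f" and g: "lie_hom G (carrier G) A g"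
  shows "lie_hom G (carrier G) A (\<lambda>x. f x \<otimes>\<^bsub>A\<^esub> inv\<^bsub>A\<^esub> g x)"
proof -
  interpret A: comm_group A by fact
  show ?thesis
    by (rule lie_homI) (simp_all add: lie_homD[OF f] lie_homD[OF g] A.inv_mult A.m_ac)
qed

lemma lie_hom_is_hom:
  assumes A: "group A" and f: "lie_hom G (carrier G) A f"
    and trivial: "\<And>c. c \<in> lower_central G 2 \<Longrightarrow> f c = \<one>\<^bsub>A\<^esub>"
  shows "f \<in> hom G A"
proof -
  interpret A: group A by fact
  show ?thesis
    by (rule homI) (simp_all add: lie_hom_mult[OF A f] lie_hom_closed[OF f] trivial)
qed

text \<open>Expanding with \<open>lie_hom_mult\<close>, each of \<open>f u\<close>,
  \<open>f x\<close> and \<open>f [x, u]\<close> occurs three times, as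
  \<open>[x, u x] = [x, u]\<close>. This is what makes Baer-linear maps twisted functions.\<close>

lemma lie_hom_norm:
  assumes A: "comm_group A" and cubeA: "\<And>a. a \<in> carrier A \<Longrightarrow> a \<otimes>\<^bsub>A\<^esub> (a \<otimes>\<^bsub>A\<^esub> a) = \<one>\<^bsub>A\<^esub>"
    and f: "lie_hom G (carrier G) A f" and ux: "u \<in> carrier G" "x \<in> carrier G"
  shows "f u \<otimes>\<^bsub>A\<^esub> (f (u \<otimes> x) \<otimes>\<^bsub>A\<^esub> f (u \<otimes> x \<otimes> x)) = \<one>\<^bsub>A\<^esub>"
proof -
  interpret A: comm_group A by fact
  let ?c = "commutator G x u"
  have "commutator G x (u \<otimes> x) = ?c"
    using ux by (simp add: commutator_def inv_mult_group m_assoc)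
  then have 2: "f (u \<otimes> x \<otimes> x) = f (u \<otimes> x) \<otimes>\<^bsub>A\<^esub> f x \<otimes>\<^bsub>A\<^esub> f ?c"
    using lie_hom_mult[OF A.group_axioms f, of "u \<otimes> x" x] ux by simp
  have 1: "f (u \<otimes> x) = f u \<otimes>\<^bsub>A\<^esub> f x \<otimes>\<^bsub>A\<^esub> f ?c"
    using lie_hom_mult[OF A.group_axioms f] ux by simp
  have closed: "f u \<in> carrier A" "f x \<in> carrier A" "f ?c \<in> carrier A"
    using ux by (simp_all add: lie_hom_closed[OF f])
  have "f u \<otimes>\<^bsub>A\<^esub> (f (u \<otimes> x) \<otimes>\<^bsub>A\<^esub> f (u \<otimes> x \<otimes> x))
      = (f u \<otimes>\<^bsub>A\<^esub> (f u \<otimes>\<^bsub>A\<^esub> f u)) \<otimes>\<^bsub>A\<^esub> ((f x \<otimes>\<^bsub>A\<^esub> (f x \<otimes>\<^bsub>A\<^esub> f x)) \<otimes>\<^bsub>A\<^esub> (f ?c \<otimes>\<^bsub>A\<^esub> (f ?c \<otimes>\<^bsub>A\<^esub> f ?c)))"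
    unfolding 2 1 using closed by (simp add: A.m_ac)
  then show ?thesis using closed by (simp add: cubeA)
qed

end

text \<open>Functions on which every right translation \<open>x\<close> satisfies \<open>1 + x + x\<^sup>2 = 0\<close>: this is exactly what makes the
  wreath-type product below have exponent 3.\<close>

definition twisted_functions :: "('a, 'c) monoid_scheme \<Rightarrow> ('b, 'd) monoid_scheme \<Rightarrow> ('a \<Rightarrow> 'b) set" where
  "twisted_functions X A = {f \<in> carrier X \<rightarrow>\<^sub>E carrier A. \<forall>u\<in>carrier X. \<forall>x\<in>carrier X.
    f u \<otimes>\<^bsub>A\<^esub> (f (u \<otimes>\<^bsub>X\<^esub> x) \<otimes>\<^bsub>A\<^esub> f (u \<otimes>\<^bsub>X\<^esub> x \<otimes>\<^bsub>X\<^esub> x)) = \<one>\<^bsub>A\<^esub>}"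

text \<open>A subgroup of the unrestricted wreath product of \<open>A\<close> by \<open>X\<close>,
  which acts on functions by right translation. Functions are restricted to
  \<open>carrier X\<close>, so that they are equal when they agree there.\<close>

definition twisted_product ::
  "('a, 'c) monoid_scheme \<Rightarrow> ('b, 'd) monoid_scheme \<Rightarrow> (('a \<Rightarrow> 'b) \<times> 'a) monoid" where
  "twisted_product X A =
    \<lparr>carrier = twisted_functions X A \<times> carrier X,
     monoid.mult = (\<lambda>p q. (\<lambda>u\<in>carrier X. fst p u \<otimes>\<^bsub>A\<^esub> fst q (u \<otimes>\<^bsub>X\<^esub> snd p), snd p \<otimes>\<^bsub>X\<^esub> snd q)),
     one = (\<lambda>u\<in>carrier X. \<one>\<^bsub>A\<^esub>, \<one>\<^bsub>X\<^esub>)\<rparr>"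

section \<open>The twisted product as a group of exponent 3\<close>

locale twisted = X: V3_group X + A: comm_group A
  for X :: "('a, 'c) monoid_scheme" and A :: "('b, 'd) monoid_scheme" +
  assumes A_cube: "a \<in> carrier A \<Longrightarrow> a \<otimes>\<^bsub>A\<^esub> (a \<otimes>\<^bsub>A\<^esub> a) = \<one>\<^bsub>A\<^esub>"
begin

abbreviation "K \<equiv> twisted_product X A"

lemma K_simps [simp]:
  "(f, x) \<in> carrier K \<longleftrightarrow> f \<in> twisted_functions X A \<and> x \<in> carrier X"
  "(f, x) \<otimes>\<^bsub>K\<^esub> (g, y) = (\<lambda>u\<in>carrier X. f u \<otimes>\<^bsub>A\<^esub> g (u \<otimes>\<^bsub>X\<^esub> x), x \<otimes>\<^bsub>X\<^esub> y)"
  "\<one>\<^bsub>K\<^esub> = (\<lambda>u\<in>carrier X. \<one>\<^bsub>A\<^esub>, \<one>\<^bsub>X\<^esub>)"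
  by (simp_all add: twisted_product_def)

lemma twisted_functions_closed:
  "\<lbrakk>f \<in> twisted_functions X A; u \<in> carrier X\<rbrakk> \<Longrightarrow> f u \<in> carrier A"
  by (auto simp: twisted_functions_def)

lemma twisted_functionsI:
  assumes "\<And>u. u \<in> carrier X \<Longrightarrow> f u \<in> carrier A"
    and "\<And>u x. \<lbrakk>u \<in> carrier X; x \<in> carrier X\<rbrakk>
      \<Longrightarrow> f u \<otimes>\<^bsub>A\<^esub> (f (u \<otimes>\<^bsub>X\<^esub> x) \<otimes>\<^bsub>A\<^esub> f (u \<otimes>\<^bsub>X\<^esub> x \<otimes>\<^bsub>X\<^esub> x)) = \<one>\<^bsub>A\<^esub>"
  shows "restrict f (carrier X) \<in> twisted_functions X A"
  using assms by (simp add: twisted_functions_def)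

lemma twisted_functionsD:
  "\<lbrakk>f \<in> twisted_functions X A; u \<in> carrier X; x \<in> carrier X\<rbrakk>
    \<Longrightarrow> f u \<otimes>\<^bsub>A\<^esub> (f (u \<otimes>\<^bsub>X\<^esub> x) \<otimes>\<^bsub>A\<^esub> f (u \<otimes>\<^bsub>X\<^esub> x \<otimes>\<^bsub>X\<^esub> x)) = \<one>\<^bsub>A\<^esub>"
  by (simp add: twisted_functions_def)

lemma twisted_functions_ext:
  "\<lbrakk>f \<in> twisted_functions X A; \<And>u. u \<in> carrier X \<Longrightarrow> f u = g u\<rbrakk> \<Longrightarrow> restrict g (carrier X) = f"
  by (intro ext) (auto simp: twisted_functions_def PiE_def extensional_def)

lemma twisted_functions_translate:
  assumes f: "f \<in> twisted_functions X A" and w: "w \<in> carrier X"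
  shows "(\<lambda>u\<in>carrier X. f (u \<otimes>\<^bsub>X\<^esub> w)) \<in> twisted_functions X A"
proof (rule twisted_functionsI)
  show "f (u \<otimes>\<^bsub>X\<^esub> w) \<in> carrier A" if "u \<in> carrier X" for u using that w by (simp add: twisted_functions_closed[OF f])
  fix u x assume ux: "u \<in> carrier X" "x \<in> carrier X"
  \<comment> \<open>As \<open>u x w = (u w) (w^-1 x w)\<close>, this is the condition on
    \<open>f\<close> at the point \<open>u w\<close> for a conjugate of \<open>x\<close>.\<close>
  show "f (u \<otimes>\<^bsub>X\<^esub> w) \<otimes>\<^bsub>A\<^esub> (f (u \<otimes>\<^bsub>X\<^esub> x \<otimes>\<^bsub>X\<^esub> w) \<otimes>\<^bsub>A\<^esub> f (u \<otimes>\<^bsub>X\<^esub> x \<otimes>\<^bsub>X\<^esub> x \<otimes>\<^bsub>X\<^esub> w)) = \<one>\<^bsub>A\<^esub>"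
    using twisted_functionsD[OF f, of "u \<otimes>\<^bsub>X\<^esub> w" "inv\<^bsub>X\<^esub> w \<otimes>\<^bsub>X\<^esub> (x \<otimes>\<^bsub>X\<^esub> w)"] ux w
    by (simp add: X.m_assoc)
qed

lemma twisted_functions_mult:
  assumes f: "f \<in> twisted_functions X A" and g: "g \<in> twisted_functions X A"
  shows "(\<lambda>u\<in>carrier X. f u \<otimes>\<^bsub>A\<^esub> g u) \<in> twisted_functions X A"
proof (rule twisted_functionsI)
  show "f u \<otimes>\<^bsub>A\<^esub> g u \<in> carrier A" if "u \<in> carrier X" for u
    using that by (simp add: twisted_functions_closed[OF f] twisted_functions_closed[OF g])
  fix u x assume ux: "u \<in> carrier X" "x \<in> carrier X"
  let ?v = "u \<otimes>\<^bsub>X\<^esub> x" and ?w = "u \<otimes>\<^bsub>X\<^esub> x \<otimes>\<^bsub>X\<^esub> x"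
  have "f u \<otimes>\<^bsub>A\<^esub> g u \<otimes>\<^bsub>A\<^esub> (f ?v \<otimes>\<^bsub>A\<^esub> g ?v \<otimes>\<^bsub>A\<^esub> (f ?w \<otimes>\<^bsub>A\<^esub> g ?w))
      = (f u \<otimes>\<^bsub>A\<^esub> (f ?v \<otimes>\<^bsub>A\<^esub> f ?w)) \<otimes>\<^bsub>A\<^esub> (g u \<otimes>\<^bsub>A\<^esub> (g ?v \<otimes>\<^bsub>A\<^esub> g ?w))"
    using ux by (simp add: twisted_functions_closed[OF f] twisted_functions_closed[OF g] A.m_ac)
  then show "f u \<otimes>\<^bsub>A\<^esub> g u \<otimes>\<^bsub>A\<^esub> (f ?v \<otimes>\<^bsub>A\<^esub> g ?v \<otimes>\<^bsub>A\<^esub> (f ?w \<otimes>\<^bsub>A\<^esub> g ?w)) = \<one>\<^bsub>A\<^esub>"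
    using ux by (simp add: twisted_functionsD[OF f] twisted_functionsD[OF g])
qed

lemma twisted_functions_mult_translate:
  assumes f: "f \<in> twisted_functions X A" and g: "g \<in> twisted_functions X A" and w: "w \<in> carrier X"
  shows "(\<lambda>u\<in>carrier X. f u \<otimes>\<^bsub>A\<^esub> g (u \<otimes>\<^bsub>X\<^esub> w)) \<in> twisted_functions X A"
proof -
  have "(\<lambda>u\<in>carrier X. f u \<otimes>\<^bsub>A\<^esub> g (u \<otimes>\<^bsub>X\<^esub> w))
      = (\<lambda>u\<in>carrier X. f u \<otimes>\<^bsub>A\<^esub> (\<lambda>u\<in>carrier X. g (u \<otimes>\<^bsub>X\<^esub> w)) u)"
    by (rule restrict_ext) simp
  then show ?thesis
    using twisted_functions_mult[OF f twisted_functions_translate[OF g w]] by simp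
qed

lemma twisted_functions_inv:
  assumes f: "f \<in> twisted_functions X A"
  shows "(\<lambda>u\<in>carrier X. inv\<^bsub>A\<^esub> f u) \<in> twisted_functions X A"
proof (rule twisted_functionsI)
  show "inv\<^bsub>A\<^esub> f u \<in> carrier A" if "u \<in> carrier X" for u
    using that by (simp add: twisted_functions_closed[OF f])
  fix u x assume ux: "u \<in> carrier X" "x \<in> carrier X"
  let ?v = "u \<otimes>\<^bsub>X\<^esub> x" and ?w = "u \<otimes>\<^bsub>X\<^esub> x \<otimes>\<^bsub>X\<^esub> x"
  have "inv\<^bsub>A\<^esub> f u \<otimes>\<^bsub>A\<^esub> (inv\<^bsub>A\<^esub> f ?v \<otimes>\<^bsub>A\<^esub> inv\<^bsub>A\<^esub> f ?w) = inv\<^bsub>A\<^esub> (f u \<otimes>\<^bsub>A\<^esub> (f ?v \<otimes>\<^bsub>A\<^esub> f ?w))"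
    using ux by (simp add: twisted_functions_closed[OF f] A.inv_mult)
  then show "inv\<^bsub>A\<^esub> f u \<otimes>\<^bsub>A\<^esub> (inv\<^bsub>A\<^esub> f ?v \<otimes>\<^bsub>A\<^esub> inv\<^bsub>A\<^esub> f ?w) = \<one>\<^bsub>A\<^esub>"
    using ux by (simp add: twisted_functionsD[OF f])
qed

lemma twisted_functions_one: "(\<lambda>u\<in>carrier X. \<one>\<^bsub>A\<^esub>) \<in> twisted_functions X A"
  by (rule twisted_functionsI) simp_all

lemma K_cases:
  assumes "p \<in> carrier K"
  obtains f x where "p = (f, x)" "f \<in> twisted_functions X A" "x \<in> carrier X"
  using assms by (cases p) simp

lemma K_group: "group K"
proof (rule groupI)
  fix p q assume "p \<in> carrier K" "q \<in> carrier K"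
  then show "p \<otimes>\<^bsub>K\<^esub> q \<in> carrier K"
    by (elim K_cases) (simp add: twisted_functions_mult_translate)
next
  show "\<one>\<^bsub>K\<^esub> \<in> carrier K" by (simp add: twisted_functions_one)
next
  fix p q r assume p: "p \<in> carrier K" and q: "q \<in> carrier K" and r: "r \<in> carrier K"
  obtain f x g y h z where *: "p = (f, x)" "q = (g, y)" "r = (h, z)"
    "x \<in> carrier X" "y \<in> carrier X" "z \<in> carrier X"
    and fgh: "f \<in> twisted_functions X A" "g \<in> twisted_functions X A" "h \<in> twisted_functions X A"
    using p q r by (elim K_cases) blast
  show "p \<otimes>\<^bsub>K\<^esub> q \<otimes>\<^bsub>K\<^esub> r = p \<otimes>\<^bsub>K\<^esub> (q \<otimes>\<^bsub>K\<^esub> r)"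
    using * by (simp add: twisted_functions_closed[OF fgh(1)] twisted_functions_closed[OF fgh(2)]
        twisted_functions_closed[OF fgh(3)] A.m_assoc X.m_assoc cong: restrict_cong)
next
  fix p assume "p \<in> carrier K"
  then obtain f x where fx: "p = (f, x)" "x \<in> carrier X" and f: "f \<in> twisted_functions X A"
    by (rule K_cases)
  then show "\<one>\<^bsub>K\<^esub> \<otimes>\<^bsub>K\<^esub> p = p"
    by (simp add: twisted_functions_ext[OF f] twisted_functions_closed[OF f])
  let ?g = "\<lambda>u\<in>carrier X. inv\<^bsub>A\<^esub> f (u \<otimes>\<^bsub>X\<^esub> inv\<^bsub>X\<^esub> x)"
  have "?g = (\<lambda>u\<in>carrier X. inv\<^bsub>A\<^esub> (\<lambda>u\<in>carrier X. f (u \<otimes>\<^bsub>X\<^esub> inv\<^bsub>X\<^esub> x)) u)"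
    by (rule restrict_ext) simp
  then have "?g \<in> twisted_functions X A"
    using twisted_functions_inv[OF twisted_functions_translate[OF f, of "inv\<^bsub>X\<^esub> x"]] fx by simp
  moreover have "(?g, inv\<^bsub>X\<^esub> x) \<otimes>\<^bsub>K\<^esub> p = \<one>\<^bsub>K\<^esub>"
    using fx by (simp add: twisted_functions_closed[OF f] cong: restrict_cong)
  ultimately show "\<exists>q\<in>carrier K. q \<otimes>\<^bsub>K\<^esub> p = \<one>\<^bsub>K\<^esub>"
    using fx by (intro bexI[of _ "(?g, inv\<^bsub>X\<^esub> x)"]) simp_all
qed

lemma K_cube:
  assumes "p \<in> carrier K"
  shows "p \<otimes>\<^bsub>K\<^esub> (p \<otimes>\<^bsub>K\<^esub> p) = \<one>\<^bsub>K\<^esub>"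
proof -
  obtain f x where fx: "p = (f, x)" "x \<in> carrier X" and f: "f \<in> twisted_functions X A"
    using assms by (rule K_cases)
  then show ?thesis
    by (simp add: twisted_functionsD[OF f] X.cube cong: restrict_cong)
qed

sublocale K: V3_group K
  by (intro V3_group.intro V3_group_axioms.intro K_group K_cube)

text \<open>\<open>X\<close> enters as the complement and \<open>Y\<close> enters the base:
  linearity in \<open>x\<close> makes the functions \<open>\<beta> _ y\<close> twisted, and
  multiplicativity in \<open>y\<close> makes \<open>j\<close> a homomorphism. The function part of
  \<open>[i x, j y]\<close> at \<open>u\<close> is \<open>\<beta> (u x) y\<close> divided by
  \<open>\<beta> u y\<close>, which at \<open>u = 1\<close> is \<open>\<beta> x y\<close>.\<close>

lemma twisted_commutator:
  assumes Y: "group Y"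
    and left: "\<And>y. y \<in> carrier Y \<Longrightarrow> lie_hom X (carrier X) A (\<lambda>x. \<beta> x y)"
    and right: "\<And>x. x \<in> carrier X \<Longrightarrow> \<beta> x \<in> hom Y A"
  defines "i \<equiv> \<lambda>x. (\<lambda>u\<in>carrier X. \<one>\<^bsub>A\<^esub>, x)"
    and "j \<equiv> \<lambda>y. (\<lambda>u\<in>carrier X. \<beta> u y, \<one>\<^bsub>X\<^esub>)"
  shows "i \<in> hom X K" "j \<in> hom Y K"
    and "\<lbrakk>x \<in> carrier X; y \<in> carrier Y\<rbrakk> \<Longrightarrow> snd (commutator K (i x) (j y)) = \<one>\<^bsub>X\<^esub>"
    and "\<lbrakk>x \<in> carrier X; y \<in> carrier Y\<rbrakk> \<Longrightarrow> fst (commutator K (i x) (j y)) \<one>\<^bsub>X\<^esub> = \<beta> x y"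
proof -
  have closed: "\<beta> x y \<in> carrier A" if "x \<in> carrier X" "y \<in> carrier Y" for x y
    by (rule X.lie_hom_closed[OF left[OF that(2)] that(1)])
  have twisted: "(\<lambda>u\<in>carrier X. \<beta> u y) \<in> twisted_functions X A" if "y \<in> carrier Y" for y
    by (rule twisted_functionsI)
      (use that closed X.lie_hom_norm[OF A.comm_group_axioms A_cube left[OF that]] in auto)
  show i: "i \<in> hom X K"
    by (rule homI) (auto simp: i_def twisted_functions_one intro!: restrict_ext)
  show j: "j \<in> hom Y K"
    by (rule homI) (auto simp: j_def twisted hom_mult[OF right] intro!: restrict_ext)
  assume xy: "x \<in> carrier X" "y \<in> carrier Y"
  have K: "i x \<in> carrier K" "j y \<in> carrier K"
    using hom_in_carrier[OF i xy(1)] hom_in_carrier[OF j xy(2)] .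
  obtain g z where gz: "commutator K (i x) (j y) = (g, z)" by (cases "commutator K (i x) (j y)")
  have gzK: "g \<in> twisted_functions X A" "z \<in> carrier X"
    using K.commutator_closed[OF K] gz by simp_all
  \<comment> \<open>Comparing \<open>[i x, j y] j y i x\<close> with \<open>i x j y\<close> avoids
    computing inverses in \<open>K\<close>.\<close>
  have "commutator K (i x) (j y) \<otimes>\<^bsub>K\<^esub> (j y \<otimes>\<^bsub>K\<^esub> i x) = i x \<otimes>\<^bsub>K\<^esub> j y"
    using K by (simp add: commutator_def K.m_assoc del: K_simps)
  then have eq: "(g, z) \<otimes>\<^bsub>K\<^esub> (j y \<otimes>\<^bsub>K\<^esub> i x) = i x \<otimes>\<^bsub>K\<^esub> j y"
    by (simp only: gz)
  have "z \<otimes>\<^bsub>X\<^esub> x = x"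
    using arg_cong[OF eq, of snd] xy by (simp add: i_def j_def)
  then have z: "z = \<one>\<^bsub>X\<^esub>" using xy gzK by simp
  then show "snd (commutator K (i x) (j y)) = \<one>\<^bsub>X\<^esub>" using gz by simp
  have "g \<one>\<^bsub>X\<^esub> \<otimes>\<^bsub>A\<^esub> \<beta> \<one>\<^bsub>X\<^esub> y = \<beta> x y"
    using arg_cong[OF eq, of "\<lambda>p. fst p \<one>\<^bsub>X\<^esub>"] xy closed by (simp add: i_def j_def z)
  moreover have "\<beta> \<one>\<^bsub>X\<^esub> y = \<one>\<^bsub>A\<^esub>" by (rule X.lie_hom_one[OF left[OF xy(2)]])
  ultimately show "fst (commutator K (i x) (j y)) \<one>\<^bsub>X\<^esub> = \<beta> x y" using gz twisted_functions_closed[OF gzK(1) X.one_closed] by simp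
qed

end

subsection \<open>Coproducts\<close>

lemma in_V3_iff: "in_V3 G \<longleftrightarrow> V3_group G"
proof -
  have "x [^]\<^bsub>G\<^esub> (3::nat) = x \<otimes>\<^bsub>G\<^esub> (x \<otimes>\<^bsub>G\<^esub> x)" if "group G" "x \<in> carrier G" for x
  proof -
    interpret group G by fact
    show ?thesis using that by (simp add: numeral_3_eq_3 m_assoc)
  qed
  then show ?thesis
    by (auto simp: in_V3_def V3_group_def V3_group_axioms_def)
qed

lemma (in group) commutator_subgroup_consistent:
  assumes "subgroup D G" "x \<in> D" "y \<in> D"
  shows "commutator (G\<lparr>carrier := D\<rparr>) x y = commutator G x y"
  using assms by (simp add: commutator_def m_inv_consistent)

lemma (in V3_group) hom_lower_central:
  assumes X: "V3_group X" and h: "h \<in> hom X G"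
  shows "c \<in> lower_central X 2 \<Longrightarrow> h c \<in> lower_central G 2"
    and "c \<in> lower_central X 3 \<Longrightarrow> h c \<in> lower_central G 3"
proof -
  interpret X: V3_group X by fact
  interpret h: group_hom X G h by unfold_locales fact
  have "h ` lower_central X 2 = generate G (h ` (\<Union>x\<in>carrier X. \<Union>y\<in>carrier X. {commutator X x y}))"
    unfolding X.lower_central_2 by (rule h.generate_img[symmetric]) auto
  also have "\<dots> \<subseteq> lower_central G 2"
    by (rule generate_subgroup_incl[OF _ lower_central_2_subgroup]) (auto simp: h.hom_commutator)
  finally have 2: "h c \<in> lower_central G 2" if "c \<in> lower_central X 2" for c using that by blast
  show "h c \<in> lower_central G 2" if "c \<in> lower_central X 2" by (rule 2[OF that])
  have "h ` lower_central X 3 = generate G (h ` (\<Union>x\<in>lower_central X 2. \<Union>y\<in>carrier X. {commutator X x y}))"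
    unfolding X.lower_central_3 by (rule h.generate_img[symmetric]) auto
  also have "\<dots> \<subseteq> lower_central G 3"
    by (rule generate_subgroup_incl[OF _ lower_central_3_subgroup]) (auto simp: h.hom_commutator 2)
  finally show "h c \<in> lower_central G 3" if "c \<in> lower_central X 3" using that by blast
qed

context V3_group begin

lemma lower_central_2_comm_group: "comm_group (G\<lparr>carrier := lower_central G 2\<rparr>)"
  by (rule comm_group_subgroupI[OF lower_central_2_subgroup lower_central_2_commute])

lemma commutator_product_right:
  assumes "x \<in> carrier G" "y \<in> carrier G" "z \<in> carrier G"
  shows "commutator G z (x \<otimes> y)
    = commutator G z x \<otimes> commutator G z y \<otimes> commutator G z (commutator G y x)"
proof -
  interpret A: comm_group "G\<lparr>carrier := lower_central G 2\<rparr>" by (rule lower_central_2_comm_group)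
  have "commutator G z (x \<otimes> y) = inv (commutator G (x \<otimes> y) z)"
    using assms by (simp add: inv_commutator)
  also have "\<dots> = commutator G z (commutator G y x) \<otimes> (commutator G z y \<otimes> commutator G z x)"
    using assms by (simp add: commutator_product inv_mult_group inv_commutator)
  also have "\<dots> = commutator G z x \<otimes> commutator G z y \<otimes> commutator G z (commutator G y x)"
    using assms A.m_closed[simplified] A.m_ac[simplified] by simp
  finally show ?thesis .
qed

lemma commutator_lower_central_3 [simp]:
  assumes "c \<in> lower_central G 3" "x \<in> carrier G"
  shows "commutator G c x = \<one>" "commutator G x c = \<one>"
  using assms lower_central_3_commute[OF assms]
  by (simp_all add: commutator_eq_one_iff)

text \<open>The two product formulas for commutators have the form that \<open>lie_homI_mult\<close>
  asks for. The target \<open>\<gamma>\<^sub>2\<close> is abelian, and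
  \<open>\<gamma>\<^sub>3\<close> is killed because it is central.\<close>

lemma commutator_lie_hom:
  assumes X: "V3_group X" and h: "h \<in> hom X G" and p: "p \<in> carrier G"
  shows "lie_hom X (carrier X) (G\<lparr>carrier := lower_central G 2\<rparr>) (\<lambda>x. commutator G (h x) p)"
    and "lie_hom X (carrier X) (G\<lparr>carrier := lower_central G 2\<rparr>) (\<lambda>x. commutator G p (h x))"
proof -
  interpret X: V3_group X by fact
  interpret h: group_hom X G h by unfold_locales fact
  show "lie_hom X (carrier X) (G\<lparr>carrier := lower_central G 2\<rparr>) (\<lambda>x. commutator G (h x) p)"
    by (rule X.lie_homI_mult[OF lower_central_2_comm_group])
      (simp_all add: p commutator_product h.hom_commutator hom_lower_central(2)[OF X h])
  show "lie_hom X (carrier X) (G\<lparr>carrier := lower_central G 2\<rparr>) (\<lambda>x. commutator G p (h x))"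
    by (rule X.lie_homI_mult[OF lower_central_2_comm_group])
      (simp_all add: p commutator_product_right h.hom_commutator hom_lower_central(2)[OF X h])
qed

lemma commutator_lower_central_2_one:
  assumes "c \<in> lower_central G 2" "d \<in> lower_central G 2"
  shows "commutator G c d = \<one>"
  using assms lower_central_2_commute[OF assms] by (simp add: commutator_eq_one_iff)

end

section \<open>A normal form for the elements of a coproduct\<close>

lemma V3_coproduct_induct [consumes 3, case_names one inl inr]:
  assumes G: "group G" and H: "group H"
    and "w \<in> carrier (V3_coproduct G H)"
    and "P \<one>\<^bsub>V3_coproduct G H\<^esub>"
    and "\<And>x w. \<lbrakk>x \<in> carrier G; w \<in> carrier (V3_coproduct G H); P w\<rbrakk>
      \<Longrightarrow> P (V3_inl G H x \<otimes>\<^bsub>V3_coproduct G H\<^esub> w)"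
    and "\<And>y w. \<lbrakk>y \<in> carrier H; w \<in> carrier (V3_coproduct G H); P w\<rbrakk>
      \<Longrightarrow> P (V3_inr G H y \<otimes>\<^bsub>V3_coproduct G H\<^esub> w)"
  shows "P w"
proof -
  note p = V3_proj_hom[OF G H]
  have V: "group (V3_coproduct G H)" using V3_coproduct_in_V3[OF G H] by (simp add: in_V3_def)
  obtain X where X: "X \<in> carrier (free_product G H)" "w = V3_proj G H X"
    using assms(3) p(2) by blast
  have "P (V3_proj G H X)"
    using X(1)
  proof (induction rule: free_product_induct)
    case one
    then show ?case using assms(4) hom_one[OF p(1) free_product_group[OF G H] V] by simp
  next
    case (inl x Y)
    then show ?case
      using assms(5)[of x "V3_proj G H Y"] hom_mult[OF p(1)] hom_in_carrier[OF p(1)]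
        hom_in_carrier[OF free_product_inl_hom[OF G, of H] inl(1)] by (simp add: V3_inl_def)
  next
    case (inr y Y)
    then show ?case
      using assms(6)[of y "V3_proj G H Y"] hom_mult[OF p(1)] hom_in_carrier[OF p(1)]
        hom_in_carrier[OF free_product_inr_hom[OF H, of G] inr(1)] by (simp add: V3_inr_def)
  qed
  then show ?thesis using X by simp
qed

text \<open>For \<open>G\<close> and \<open>H\<close> of exponent 3 this is the kernel of the map
  from the coproduct to the direct product. It is given by generators, so that inclusions and
  homomorphisms can be checked on mixed commutators.\<close>

definition cartesian_subgroup ::
  "('a, 'c) monoid_scheme \<Rightarrow> ('b, 'd) monoid_scheme \<Rightarrow> ('a + 'b) list set set set" where
  "cartesian_subgroup G H = generate (V3_coproduct G H)
    (\<Union>x\<in>carrier G. \<Union>y\<in>carrier H. {commutator (V3_coproduct G H) (V3_inl G H x) (V3_inr G H y)})"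

locale V3_pair = G: group G + H: group H
  for G :: "('a, 'c) monoid_scheme" and H :: "('b, 'd) monoid_scheme"
begin

abbreviation "P \<equiv> V3_coproduct G H"
abbreviation "L \<equiv> V3_inl G H"
abbreviation "R \<equiv> V3_inr G H"

sublocale P: V3_group P
  using V3_coproduct_in_V3[OF G.group_axioms H.group_axioms] by (simp add: in_V3_iff)

sublocale L: group_hom G P L
  by unfold_locales (rule V3_inl_hom[OF G.group_axioms H.group_axioms])

sublocale R: group_hom H P R
  by unfold_locales (rule V3_inr_hom[OF G.group_axioms H.group_axioms])

lemma cartesian_subgroup: "subgroup (cartesian_subgroup G H) P"
  unfolding cartesian_subgroup_def by (rule P.generate_is_subgroup) auto

lemma commutator_in_cartesian_subgroup:
  "\<lbrakk>x \<in> carrier G; y \<in> carrier H\<rbrakk> \<Longrightarrow> commutator P (L x) (R y) \<in> cartesian_subgroup G H"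
  unfolding cartesian_subgroup_def by (rule generate.incl) blast

lemma cartesian_subgroup_minimal:
  assumes "subgroup T P" "\<And>x y. \<lbrakk>x \<in> carrier G; y \<in> carrier H\<rbrakk> \<Longrightarrow> commutator P (L x) (R y) \<in> T"
  shows "cartesian_subgroup G H \<subseteq> T"
  unfolding cartesian_subgroup_def using assms by (intro P.generate_subgroup_incl) blast+

text \<open>On generators, \<open>y [x, z] y^-1 = [x, y]^-1 [x, y z]\<close>. This lets commutators
  move past \<open>R y\<close> in the normal form.\<close>

lemma cartesian_subgroup_conj:
  assumes c: "c \<in> cartesian_subgroup G H" and y: "y \<in> carrier H"
  shows "P.conj (R y) c \<in> cartesian_subgroup G H"
proof -
  interpret C: subgroup "cartesian_subgroup G H" P by (rule cartesian_subgroup)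
  let ?T = "{c \<in> carrier P. P.conj (R y) c \<in> cartesian_subgroup G H}"
  have "cartesian_subgroup G H \<subseteq> ?T"
  proof (rule cartesian_subgroup_minimal)
    show "subgroup ?T P"
    proof (rule P.subgroupI)
      have "\<one>\<^bsub>P\<^esub> \<in> ?T" using y by simp
      then show "?T \<noteq> {}" by blast
    next
      fix a assume "a \<in> ?T"
      then show "inv\<^bsub>P\<^esub> a \<in> ?T" using y P.inv_conj[of "R y" a, symmetric] by simp
    next
      fix a b assume "a \<in> ?T" "b \<in> ?T"
      then show "a \<otimes>\<^bsub>P\<^esub> b \<in> ?T" using y by (simp add: P.conj_mult)
    qed auto
    fix x z assume xz: "x \<in> carrier G" "z \<in> carrier H"
    have "P.conj (R y) (commutator P (L x) (R z))
        = inv\<^bsub>P\<^esub> commutator P (L x) (R y) \<otimes>\<^bsub>P\<^esub> commutator P (L x) (R (y \<otimes>\<^bsub>H\<^esub> z))"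
      using xz y by (simp add: P.conj_def commutator_def P.inv_mult_group P.m_assoc)
    also have "\<dots> \<in> cartesian_subgroup G H"
      using xz y
      by (intro C.m_closed C.m_inv_closed commutator_in_cartesian_subgroup H.m_closed)
    finally show "commutator P (L x) (R z) \<in> ?T" using xz by simp
  qed
  then show ?thesis using c by blast
qed

lemma V3_coproduct_decompose:
  assumes "w \<in> carrier P"
  shows "\<exists>x\<in>carrier G. \<exists>y\<in>carrier H. \<exists>c\<in>cartesian_subgroup G H. w = L x \<otimes>\<^bsub>P\<^esub> (R y \<otimes>\<^bsub>P\<^esub> c)"
  using G.group_axioms H.group_axioms assms
proof (induction rule: V3_coproduct_induct)
  interpret C: subgroup "cartesian_subgroup G H" P by (rule cartesian_subgroup)
  {
    case one
    then show ?case
      by (intro bexI[of _ "\<one>\<^bsub>G\<^esub>"] bexI[of _ "\<one>\<^bsub>H\<^esub>"] bexI[of _ "\<one>\<^bsub>P\<^esub>"]) auto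
  next
    case (inl x w)
    then obtain x' y c where *: "x' \<in> carrier G" "y \<in> carrier H" "c \<in> cartesian_subgroup G H"
      "w = L x' \<otimes>\<^bsub>P\<^esub> (R y \<otimes>\<^bsub>P\<^esub> c)" by blast
    then have "L x \<otimes>\<^bsub>P\<^esub> w = L (x \<otimes>\<^bsub>G\<^esub> x') \<otimes>\<^bsub>P\<^esub> (R y \<otimes>\<^bsub>P\<^esub> c)"
      using inl(1) by (simp add: P.m_assoc)
    moreover have "x \<otimes>\<^bsub>G\<^esub> x' \<in> carrier G" using inl(1) * by simp
    ultimately show ?case using * by blast
  next
    case (inr y w)
    then obtain x y' c where *: "x \<in> carrier G" "y' \<in> carrier H" "c \<in> cartesian_subgroup G H"
      "w = L x \<otimes>\<^bsub>P\<^esub> (R y' \<otimes>\<^bsub>P\<^esub> c)" by blast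
    \<comment> \<open>Here \<open>y x = x y d\<close>; moving \<open>d\<close> to the right of
      \<open>y'\<close> turns it into its conjugate \<open>?e\<close>.\<close>
    let ?d = "inv\<^bsub>P\<^esub> commutator P (L (inv\<^bsub>G\<^esub> x)) (R (inv\<^bsub>H\<^esub> y))"
    let ?e = "P.conj (R (inv\<^bsub>H\<^esub> y')) ?d"
    have e: "?e \<in> cartesian_subgroup G H"
      using * inr(1) by (intro cartesian_subgroup_conj C.m_inv_closed commutator_in_cartesian_subgroup) simp_all
    have "R y \<otimes>\<^bsub>P\<^esub> w = L x \<otimes>\<^bsub>P\<^esub> (R (y \<otimes>\<^bsub>H\<^esub> y') \<otimes>\<^bsub>P\<^esub> (?e \<otimes>\<^bsub>P\<^esub> c))"
      using * inr(1) C.mem_carrier[OF *(3)]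
      by (simp add: P.conj_def commutator_def P.inv_mult_group P.m_assoc)
    moreover have "y \<otimes>\<^bsub>H\<^esub> y' \<in> carrier H" "?e \<otimes>\<^bsub>P\<^esub> c \<in> cartesian_subgroup G H"
      using inr(1) * e by simp_all
    ultimately show ?case using * by blast
  }
qed

end

text \<open>This serves the case where the second factor of a coproduct takes the role of
  \<open>X\<close>: a mixed commutator then arrives as the inverse of
  \<open>[i x, j y]\<close>.\<close>

lemma (in twisted) K_inv_base:
  assumes p: "p \<in> carrier K" and base: "snd p = \<one>\<^bsub>X\<^esub>"
  shows "snd (inv\<^bsub>K\<^esub> p) = \<one>\<^bsub>X\<^esub>" and "fst (inv\<^bsub>K\<^esub> p) \<one>\<^bsub>X\<^esub> = inv\<^bsub>A\<^esub> fst p \<one>\<^bsub>X\<^esub>"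
proof -
  obtain g where g: "p = (g, \<one>\<^bsub>X\<^esub>)" "g \<in> twisted_functions X A"
    using p base by (elim K_cases) simp
  obtain h z where h: "inv\<^bsub>K\<^esub> p = (h, z)" "h \<in> twisted_functions X A" "z \<in> carrier X"
    using K.inv_closed[OF p] by (elim K_cases)
  have eq: "(h, z) \<otimes>\<^bsub>K\<^esub> (g, \<one>\<^bsub>X\<^esub>) = \<one>\<^bsub>K\<^esub>"
    using K.l_inv[OF p] by (simp only: g(1) h(1)[unfolded g(1)])
  have z: "z = \<one>\<^bsub>X\<^esub>" using arg_cong[OF eq, of snd] h by simp
  then show "snd (inv\<^bsub>K\<^esub> p) = \<one>\<^bsub>X\<^esub>" by (simp add: h)
  have "h \<one>\<^bsub>X\<^esub> \<otimes>\<^bsub>A\<^esub> g \<one>\<^bsub>X\<^esub> = \<one>\<^bsub>A\<^esub>"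
    using arg_cong[OF eq, of "\<lambda>p. fst p \<one>\<^bsub>X\<^esub>"] by (simp add: z)
  then have "inv\<^bsub>A\<^esub> g \<one>\<^bsub>X\<^esub> = h \<one>\<^bsub>X\<^esub>"
    using twisted_functions_closed[OF g(2)] twisted_functions_closed[OF h(2)]
    by (intro A.inv_equality) simp_all
  then show "fst (inv\<^bsub>K\<^esub> p) \<one>\<^bsub>X\<^esub> = inv\<^bsub>A\<^esub> fst p \<one>\<^bsub>X\<^esub>" by (simp add: g(1) h(1)[unfolded g(1)])
qed

text \<open>Evaluation at \<open>1\<close> is multiplicative on pairs with trivial second component;
  in general the second function is read at a translated point. The second component is a
  homomorphism, so its triviality on \<open>S\<close> extends to
  \<open>generate P S\<close>.\<close>

lemma (in twisted) twisted_eval_hom: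
  assumes P: "group P" and \<Theta>: "\<Theta> \<in> hom P K" and S: "S \<subseteq> carrier P"
    and base: "\<And>s. s \<in> S \<Longrightarrow> snd (\<Theta> s) = \<one>\<^bsub>X\<^esub>"
  shows "(\<lambda>c. fst (\<Theta> c) \<one>\<^bsub>X\<^esub>) \<in> hom (P\<lparr>carrier := generate P S\<rparr>) A"
proof -
  interpret P: group P by fact
  have snd_hom: "snd \<in> hom K X"
    by (rule homI) (auto elim!: K_cases)
  interpret q: group_hom P X "\<lambda>c. snd (\<Theta> c)"
    by unfold_locales (use hom_compose[OF \<Theta> snd_hom] in \<open>simp add: comp_def\<close>)
  have "generate P S \<subseteq> kernel P X (\<lambda>c. snd (\<Theta> c))"
    using S base by (intro P.generate_subgroup_incl q.subgroup_kernel) (auto simp: kernel_def)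
  then have snd: "snd (\<Theta> c) = \<one>\<^bsub>X\<^esub>" if "c \<in> generate P S" for c
    using that by (auto simp: kernel_def)
  note C = P.generate_incl[OF S, THEN subsetD]
  have \<Theta>_pair: "\<exists>f. \<Theta> c = (f, \<one>\<^bsub>X\<^esub>) \<and> f \<in> twisted_functions X A" if "c \<in> generate P S" for c
    using hom_in_carrier[OF \<Theta> C[OF that]] snd[OF that] by (cases "\<Theta> c") simp
  show ?thesis
  proof (rule homI)
    fix c assume "c \<in> carrier (P\<lparr>carrier := generate P S\<rparr>)"
    then obtain f where "\<Theta> c = (f, \<one>\<^bsub>X\<^esub>)" "f \<in> twisted_functions X A" using \<Theta>_pair by auto
    then show "fst (\<Theta> c) \<one>\<^bsub>X\<^esub> \<in> carrier A" using twisted_functions_closed[of f] by simp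
  next
    fix c d assume cd: "c \<in> carrier (P\<lparr>carrier := generate P S\<rparr>)" "d \<in> carrier (P\<lparr>carrier := generate P S\<rparr>)"
    then obtain f g where "\<Theta> c = (f, \<one>\<^bsub>X\<^esub>)" "\<Theta> d = (g, \<one>\<^bsub>X\<^esub>)"
      using \<Theta>_pair[of c] \<Theta>_pair[of d] by auto
    then show "fst (\<Theta> (c \<otimes>\<^bsub>P\<lparr>carrier := generate P S\<rparr>\<^esub> d)) \<one>\<^bsub>X\<^esub>
        = fst (\<Theta> c) \<one>\<^bsub>X\<^esub> \<otimes>\<^bsub>A\<^esub> fst (\<Theta> d) \<one>\<^bsub>X\<^esub>"
      using cd C by (simp add: hom_mult[OF \<Theta>])
  qed
qed

lemma (in group) hom_eq_on_generate:
  assumes S: "S \<subseteq> carrier G" and A: "group A"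
    and f: "f \<in> hom (G\<lparr>carrier := generate G S\<rparr>) A" and g: "g \<in> hom (G\<lparr>carrier := generate G S\<rparr>) A"
    and eq: "\<And>s. s \<in> S \<Longrightarrow> f s = g s" and c: "c \<in> generate G S"
  shows "f c = g c"
proof -
  have C: "subgroup (generate G S) G" by (rule generate_is_subgroup[OF S])
  interpret C: group "G\<lparr>carrier := generate G S\<rparr>" by (rule subgroup.subgroup_is_group[OF C group_axioms])
  interpret f: group_hom "G\<lparr>carrier := generate G S\<rparr>" A f
    using f A C.group_axioms by (simp add: group_hom_def group_hom_axioms_def)
  interpret g: group_hom "G\<lparr>carrier := generate G S\<rparr>" A g
    using g A C.group_axioms by (simp add: group_hom_def group_hom_axioms_def)
  show ?thesis
    using c
  proof induction
    case one
    then show ?case using f.hom_one g.hom_one by simp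
  next
    case (incl h)
    then show ?case by (rule eq)
  next
    case (inv h)
    then show ?case
      using f.hom_inv[of h] g.hom_inv[of h] eq[OF inv] m_inv_consistent[OF C] generate.incl[OF inv, of G]
      by simp
  next
    case (eng h k)
    then show ?case using f.hom_mult[of h k] g.hom_mult[of h k] by simp
  qed
qed

text \<open>In the normal form \<open>w = x y c\<close>, the projections of the target onto its
  factors kill the image of \<open>c\<close> and return \<open>f x\<close> and \<open>g y\<close>.
  So \<open>x\<close> and \<open>y\<close> are trivial for \<open>w\<close> in the kernel, and only
  the Cartesian subgroup remains.\<close>

lemma V3_coproduct_map_mon:
  assumes G: "V3_group G" and H: "V3_group H" and G': "V3_group G'" and H': "V3_group H'"
    and f: "f \<in> mon G G'" and g: "g \<in> mon H H'"
    and cartesian: "\<And>c. \<lbrakk>c \<in> cartesian_subgroup G H; V3_coproduct_map G' H' f g c = \<one>\<^bsub>V3_coproduct G' H'\<^esub>\<rbrakk>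
      \<Longrightarrow> c = \<one>\<^bsub>V3_coproduct G H\<^esub>"
  shows "V3_coproduct_map G' H' f g \<in> mon (V3_coproduct G H) (V3_coproduct G' H')"
proof -
  interpret G: V3_group G by fact
  interpret H: V3_group H by fact
  interpret G': V3_group G' by fact
  interpret H': V3_group H' by fact
  interpret p: V3_pair G H ..
  interpret p': V3_pair G' H' ..
  let ?m = "V3_coproduct_map G' H' f g"
  have fg: "f \<in> hom G G'" "inj_on f (carrier G)" "g \<in> hom H H'" "inj_on g (carrier H)"
    using f g by (simp_all add: mon_def)
  note m = V3_coproduct_map_hom[OF G.group_axioms H.group_axioms G'.group_axioms H'.group_axioms fg(1,3)]
  interpret m: group_hom p.P p'.P ?m by unfold_locales (rule m(1))
  interpret f: group_hom G G' f by unfold_locales (rule fg(1))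
  interpret g: group_hom H H' g by unfold_locales (rule fg(3))
  have "(\<lambda>x. \<one>\<^bsub>G'\<^esub>) \<in> hom H' G'" "(\<lambda>x. \<one>\<^bsub>H'\<^esub>) \<in> hom G' H'" "(\<lambda>x. x) \<in> hom G' G'" "(\<lambda>x. x) \<in> hom H' H'"
    by (auto simp: hom_def)
  note triv = this
  obtain q1 where q1: "q1 \<in> hom p'.P G'" "\<And>x. x \<in> carrier G' \<Longrightarrow> q1 (p'.L x) = x"
    "\<And>y. y \<in> carrier H' \<Longrightarrow> q1 (p'.R y) = \<one>\<^bsub>G'\<^esub>"
    using V3_coproduct_universal[OF G'.group_axioms H'.group_axioms _ triv(3,1)] G' by (auto simp: in_V3_iff)
  obtain q2 where q2: "q2 \<in> hom p'.P H'" "\<And>x. x \<in> carrier G' \<Longrightarrow> q2 (p'.L x) = \<one>\<^bsub>H'\<^esub>"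
    "\<And>y. y \<in> carrier H' \<Longrightarrow> q2 (p'.R y) = y"
    using V3_coproduct_universal[OF G'.group_axioms H'.group_axioms _ triv(2,4)] H' by (auto simp: in_V3_iff)
  interpret q1: group_hom p'.P G' q1 by unfold_locales (rule q1(1))
  interpret q2: group_hom p'.P H' q2 by unfold_locales (rule q2(1))
  interpret C: subgroup "cartesian_subgroup G H" p.P by (rule p.cartesian_subgroup)
  interpret k1: group_hom p.P G' "\<lambda>w. q1 (?m w)"
    by unfold_locales (use hom_compose[OF m(1) q1(1)] in \<open>simp add: comp_def\<close>)
  interpret k2: group_hom p.P H' "\<lambda>w. q2 (?m w)"
    by unfold_locales (use hom_compose[OF m(1) q2(1)] in \<open>simp add: comp_def\<close>)
  have "cartesian_subgroup G H \<subseteq> kernel p.P G' (\<lambda>w. q1 (?m w))"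
    by (rule p.cartesian_subgroup_minimal[OF k1.subgroup_kernel])
      (simp add: kernel_def m.hom_commutator q1.hom_commutator m(2,3) q1(2,3))
  then have C1: "q1 (?m c) = \<one>\<^bsub>G'\<^esub>" if "c \<in> cartesian_subgroup G H" for c
    using that by (auto simp: kernel_def)
  have "cartesian_subgroup G H \<subseteq> kernel p.P H' (\<lambda>w. q2 (?m w))"
    by (rule p.cartesian_subgroup_minimal[OF k2.subgroup_kernel])
      (simp add: kernel_def m.hom_commutator q2.hom_commutator m(2,3) q2(2,3))
  then have C2: "q2 (?m c) = \<one>\<^bsub>H'\<^esub>" if "c \<in> cartesian_subgroup G H" for c
    using that by (auto simp: kernel_def)
  have "w = \<one>\<^bsub>p.P\<^esub>" if w: "w \<in> carrier p.P" "?m w = \<one>\<^bsub>p'.P\<^esub>" for w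
  proof -
    obtain x y c where *: "x \<in> carrier G" "y \<in> carrier H" "c \<in> cartesian_subgroup G H"
      "w = p.L x \<otimes>\<^bsub>p.P\<^esub> (p.R y \<otimes>\<^bsub>p.P\<^esub> c)"
      using p.V3_coproduct_decompose[OF w(1)] by blast
    note c = C.mem_carrier[OF *(3)]
    have mw: "?m w = p'.L (f x) \<otimes>\<^bsub>p'.P\<^esub> (p'.R (g y) \<otimes>\<^bsub>p'.P\<^esub> ?m c)"
      using * c by (simp add: m(2,3))
    have "q1 (?m w) = f x"
      unfolding mw using * c by (simp add: q1 C1)
    then have "f x = \<one>\<^bsub>G'\<^esub>" using w(2) by simp
    then have x: "x = \<one>\<^bsub>G\<^esub>"
      using inj_onD[OF fg(2), of x "\<one>\<^bsub>G\<^esub>"] *(1) by simp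
    have "q2 (?m w) = g y"
      unfolding mw using * c by (simp add: q2 C2)
    then have "g y = \<one>\<^bsub>H'\<^esub>" using w(2) by simp
    then have y: "y = \<one>\<^bsub>H\<^esub>"
      using inj_onD[OF fg(4), of y "\<one>\<^bsub>H\<^esub>"] *(2) by simp
    have "w = c" using * c x y by simp
    then show ?thesis using cartesian[OF *(3)] w(2) by simp
  qed
  then have "inj_on ?m (carrier p.P)" by (simp add: m.inj_on_one_iff)
  then show ?thesis using m(1) by (simp add: mon_def)
qed

section \<open>Recovering the Cartesian subgroup from its image\<close>

theorem lemma4p5:
  fixes G :: "('a, 'c) monoid_scheme" and B :: "('b, 'd) monoid_scheme" and D :: "'a set"
  assumes "in_V3 G"
    and "subgroup D G"
    and "LCS_subgroup D G"
    and "in_V3 B"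
  shows "V3_coproduct_map G B (\<lambda>x. x) (\<lambda>y. y)
    \<in> mon (V3_coproduct (G\<lparr>carrier := D\<rparr>) B) (V3_coproduct G B)"
proof -
  define D' where "D' = G\<lparr>carrier := D\<rparr>"
  interpret G: V3_group G using assms(1) by (simp add: in_V3_iff)
  interpret B: V3_group B using assms(4) by (simp add: in_V3_iff)
  have D'_simps [simp]: "carrier D' = D" "mult D' = mult G" "\<one>\<^bsub>D'\<^esub> = \<one>\<^bsub>G\<^esub>"
    by (simp_all add: D'_def)
  have DG: "d \<in> carrier G" if "d \<in> D" for d by (rule subgroup.mem_carrier[OF assms(2) that])
  have "group D'"
    unfolding D'_def by (rule subgroup.subgroup_is_group[OF assms(2) G.group_axioms])
  then interpret D: V3_group D'
    by (intro V3_group.intro V3_group_axioms.intro) (simp_all add: G.cube DG)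
  interpret p: V3_pair D' B ..
  interpret q: V3_pair G B ..
  \<comment> \<open>The hypothesis on \<open>D\<close> enters twice: the equality for
    \<open>\<gamma>\<^sub>3\<close> makes \<open>F\<close> trivial on
    \<open>D \<inter> lower_central G 3\<close> in \<open>F_left\<close>, and the one for
    \<open>\<gamma>\<^sub>2\<close> places \<open>r c\<close> in \<open>lower_central D' 2\<close>
    in \<open>\<beta>2'\<close>.\<close>
  have lcs: "lower_central D' 2 = lower_central G 2 \<inter> D" "lower_central D' 3 = lower_central G 3 \<inter> D"
    using assms(3) by (simp_all add: LCS_subgroup_def D'_def)
  let ?m = "V3_coproduct_map G B (\<lambda>x. x) (\<lambda>y. y)"
  have id_homs: "(\<lambda>x. x) \<in> hom D' G" "(\<lambda>y. y) \<in> hom B B"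
    by (auto simp: hom_def DG)
  note m = V3_coproduct_map_hom[OF D.group_axioms B.group_axioms G.group_axioms B.group_axioms id_homs]
  interpret m: group_hom p.P q.P ?m by unfold_locales (rule m(1))

  \<comment> \<open>This group is abelian and contains all mixed commutators of the smaller
    coproduct, so it can be the value group of both twisted products.\<close>
  define A where "A = p.P\<lparr>carrier := lower_central p.P 2\<rparr>"
  interpret A: comm_group A unfolding A_def by (rule p.P.lower_central_2_comm_group)
  have A_simps: "carrier A = lower_central p.P 2" "mult A = mult p.P" "\<one>\<^bsub>A\<^esub> = \<one>\<^bsub>p.P\<^esub>"
    by (simp_all add: A_def)
  have A_cube: "a \<otimes>\<^bsub>A\<^esub> (a \<otimes>\<^bsub>A\<^esub> a) = \<one>\<^bsub>A\<^esub>" if "a \<in> carrier A" for a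
    using that by (simp add: A_simps p.P.cube)
  interpret TG: twisted G A by unfold_locales (rule A_cube)
  interpret TB: twisted B A by unfold_locales (rule A_cube)

  define F where "F d b = commutator p.P (p.L d) (p.R b)" for d b
  have F_closed: "F d b \<in> carrier A" if "d \<in> D" "b \<in> carrier B" for d b
    using that by (simp add: F_def A_simps)
  have F_left: "lie_hom G D A (\<lambda>d. F d b)" if b: "b \<in> carrier B" for b
  proof (rule lie_homI)
    note * = lie_homD[OF p.P.commutator_lie_hom(1)[OF D.V3_group_axioms p.L.homh, of "p.R b"], folded A_def F_def]
    fix x y assume xy: "x \<in> D" "y \<in> D"
    have "baer_mult D' x y = baer_mult G x y"
      using xy assms(2) by (simp add: baer_mult_def D'_def G.commutator_subgroup_consistent)
    then show "F (baer_mult G x y) b = F x b \<otimes>\<^bsub>A\<^esub> F y b" using *(2)[of x y] xy b by simp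
  next
    fix z assume "z \<in> D" "z \<in> lower_central G 3"
    then show "F z b = \<one>\<^bsub>A\<^esub>"
      using lie_homD(3)[OF p.P.commutator_lie_hom(1)[OF D.V3_group_axioms p.L.homh, of "p.R b"], of z] b
      by (simp add: A_def F_def lcs)
  qed (simp add: F_closed b)
  have F_right: "lie_hom B (carrier B) A (F d)" if d: "d \<in> D" for d
    using p.P.commutator_lie_hom(2)[OF B.V3_group_axioms p.R.homh, of "p.L d"] d
    by (simp add: A_def F_def[abs_def])
  \<comment> \<open>\<open>L d\<close> and \<open>R b\<close> both lie in
    \<open>\<gamma>\<^sub>2\<close> of the coproduct, where any two elements commute.\<close>
  have F_central: "F d b = \<one>\<^bsub>A\<^esub>" if "d \<in> lower_central D' 2" "b \<in> lower_central B 2" for d b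
    using p.P.commutator_lower_central_2_one[OF p.P.hom_lower_central(1)[OF D.V3_group_axioms p.L.homh that(1)]
        p.P.hom_lower_central(1)[OF B.V3_group_axioms p.R.homh that(2)]]
    by (simp add: F_def A_simps)

  obtain r where r: "lie_retraction G D r" by (rule G.lie_retraction_exists[OF assms(2)])
  obtain s where s: "lie_retraction B (lower_central B 2) s"
    by (rule B.lie_retraction_exists[OF B.lower_central_2_subgroup])
  note rD = lie_retractionD(1)[OF r] and s2 = lie_retractionD(1)[OF s]
  have F_left_r: "lie_hom G (carrier G) A (\<lambda>g. F (r g) b)" if "b \<in> carrier B" for b
    by (rule G.lie_hom_retraction[OF assms(2) A.group_axioms F_left[OF that] r])
  have F_right_s: "lie_hom B (carrier B) A (\<lambda>b. F d (s b))" if d: "d \<in> D" for d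
  proof (rule B.lie_hom_retraction[OF B.lower_central_2_subgroup A.group_axioms _ s])
    show "lie_hom B (lower_central B 2) A (F d)"
      by (rule lie_homI) (simp_all add: lie_homD[OF F_right[OF d]])
  qed
  \<comment> \<open>For \<open>d \<in> D\<close> we have \<open>F d b = \<beta>1 d b \<cdot> \<beta>2 b d\<close>, and each \<open>\<beta>\<close> is a homomorphism in one variable, as \<open>twisted_commutator\<close> requires; \<open>F\<close> itself is not.\<close>
  define \<beta>1 where "\<beta>1 g b = F (r g) b \<otimes>\<^bsub>A\<^esub> inv\<^bsub>A\<^esub> F (r g) (s b)" for g b
  define \<beta>2 where "\<beta>2 b g = F (r g) (s b)" for b g
  have \<beta>1: "lie_hom G (carrier G) A (\<lambda>g. \<beta>1 g b)" if "b \<in> carrier B" for b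
    unfolding \<beta>1_def using that s2[OF that]
    by (intro G.lie_hom_diff[OF A.comm_group_axioms] F_left_r) simp_all
  \<comment> \<open>A Baer-linear map that kills \<open>\<gamma>\<^sub>2\<close> is a homomorphism.
    Here \<open>s\<close> fixes \<open>\<gamma>\<^sub>2\<close> of \<open>B\<close>, so the two
    factors cancel on it.\<close>
  have \<beta>1': "\<beta>1 g \<in> hom B A" if "g \<in> carrier G" for g
    unfolding \<beta>1_def[abs_def]
  proof (rule B.lie_hom_is_hom[OF A.group_axioms])
    show "lie_hom B (carrier B) A (\<lambda>b. F (r g) b \<otimes>\<^bsub>A\<^esub> inv\<^bsub>A\<^esub> F (r g) (s b))"
      by (intro B.lie_hom_diff[OF A.comm_group_axioms] F_right F_right_s rD that)
    show "F (r g) c \<otimes>\<^bsub>A\<^esub> inv\<^bsub>A\<^esub> F (r g) (s c) = \<one>\<^bsub>A\<^esub>" if "c \<in> lower_central B 2" for c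
      using that rD[OF \<open>g \<in> carrier G\<close>] by (simp add: lie_retractionD(2)[OF s] F_closed)
  qed
  have \<beta>2: "lie_hom B (carrier B) A (\<lambda>b. \<beta>2 b g)" if "g \<in> carrier G" for g
    unfolding \<beta>2_def by (rule F_right_s[OF rD[OF that]])
  \<comment> \<open>For \<open>c\<close> in \<open>\<gamma>\<^sub>2\<close> of \<open>G\<close>,
    \<open>r c\<close> lies in \<open>\<gamma>\<^sub>2\<close> of \<open>D\<close> and
    \<open>s b\<close> in \<open>\<gamma>\<^sub>2\<close> of \<open>B\<close>, so
    \<open>F_central\<close> applies.\<close>
  have \<beta>2': "\<beta>2 b \<in> hom G A" if b: "b \<in> carrier B" for b
    unfolding \<beta>2_def[abs_def]
  proof (rule G.lie_hom_is_hom[OF A.group_axioms F_left_r])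
    show "s b \<in> carrier B" using s2[OF b] by simp
    show "F (r c) (s b) = \<one>\<^bsub>A\<^esub>" if c: "c \<in> lower_central G 2" for c
    proof (rule F_central[OF _ s2[OF b]])
      show "r c \<in> lower_central D' 2"
        using lie_retractionD(3)[OF r c] rD[of c] c by (simp add: lcs)
    qed
  qed
  \<comment> \<open>\<open>\<beta>1\<close> is a homomorphism in \<open>b\<close>, so
    \<open>G\<close> acts by translation and \<open>B\<close> goes to the base. For
    \<open>\<beta>2\<close> the roles are exchanged.\<close>
  let ?i1 = "\<lambda>x. (\<lambda>u\<in>carrier G. \<one>\<^bsub>A\<^esub>, x)" and ?j1 = "\<lambda>y. (\<lambda>u\<in>carrier G. \<beta>1 u y, \<one>\<^bsub>G\<^esub>)"
  let ?i2 = "\<lambda>x. (\<lambda>u\<in>carrier B. \<one>\<^bsub>A\<^esub>, x)" and ?j2 = "\<lambda>y. (\<lambda>u\<in>carrier B. \<beta>2 u y, \<one>\<^bsub>B\<^esub>)"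
  have t1: "?i1 \<in> hom G TG.K" "?j1 \<in> hom B TG.K"
    "\<And>x y. \<lbrakk>x \<in> carrier G; y \<in> carrier B\<rbrakk> \<Longrightarrow> snd (commutator TG.K (?i1 x) (?j1 y)) = \<one>\<^bsub>G\<^esub>"
    "\<And>x y. \<lbrakk>x \<in> carrier G; y \<in> carrier B\<rbrakk>
      \<Longrightarrow> fst (commutator TG.K (?i1 x) (?j1 y)) \<one>\<^bsub>G\<^esub> = \<beta>1 x y"
    by (rule TG.twisted_commutator[OF B.group_axioms \<beta>1 \<beta>1']; assumption)+
  have t2: "?i2 \<in> hom B TB.K" "?j2 \<in> hom G TB.K"
    "\<And>x y. \<lbrakk>x \<in> carrier B; y \<in> carrier G\<rbrakk> \<Longrightarrow> snd (commutator TB.K (?i2 x) (?j2 y)) = \<one>\<^bsub>B\<^esub>"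
    "\<And>x y. \<lbrakk>x \<in> carrier B; y \<in> carrier G\<rbrakk>
      \<Longrightarrow> fst (commutator TB.K (?i2 x) (?j2 y)) \<one>\<^bsub>B\<^esub> = \<beta>2 x y"
    by (rule TB.twisted_commutator[OF G.group_axioms \<beta>2 \<beta>2']; assumption)+
  \<comment> \<open>Through \<open>r\<close>, both \<open>\<beta>1\<close> and
    \<open>\<beta>2\<close> are defined on all of \<open>G\<close>, so these maps live on the larger
    coproduct and see only the image under \<open>?m\<close>.\<close>
  obtain \<Phi>1 where \<Phi>1: "\<Phi>1 \<in> hom q.P TG.K" "\<And>x. x \<in> carrier G \<Longrightarrow> \<Phi>1 (q.L x) = ?i1 x"
    "\<And>y. y \<in> carrier B \<Longrightarrow> \<Phi>1 (q.R y) = ?j1 y"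
    using V3_coproduct_universal[OF G.group_axioms B.group_axioms _ t1(1,2)] TG.K.V3_group_axioms
    unfolding in_V3_iff by blast
  obtain \<Phi>2 where \<Phi>2: "\<Phi>2 \<in> hom q.P TB.K" "\<And>x. x \<in> carrier G \<Longrightarrow> \<Phi>2 (q.L x) = ?j2 x"
    "\<And>y. y \<in> carrier B \<Longrightarrow> \<Phi>2 (q.R y) = ?i2 y"
    using V3_coproduct_universal[OF G.group_axioms B.group_axioms _ t2(2,1)] TB.K.V3_group_axioms
    unfolding in_V3_iff by blast
  interpret \<Phi>1: group_hom q.P TG.K \<Phi>1 by unfold_locales (rule \<Phi>1(1))
  interpret \<Phi>2: group_hom q.P TB.K \<Phi>2 by unfold_locales (rule \<Phi>2(1))

  define S where "S = (\<Union>d\<in>D. \<Union>b\<in>carrier B. {F d b})"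
  have C: "cartesian_subgroup D' B = generate p.P S"
    by (simp add: cartesian_subgroup_def S_def F_def)
  have S: "S \<subseteq> carrier p.P" "S \<subseteq> lower_central p.P 2"
    using F_closed by (auto simp: S_def A_simps)
  have mF: "?m (F d b) = commutator q.P (q.L d) (q.R b)" if "d \<in> D" "b \<in> carrier B" for d b
    using that by (simp add: F_def m.hom_commutator m(2,3))
  have e1: "snd (\<Phi>1 (?m (F d b))) = \<one>\<^bsub>G\<^esub>"
    "fst (\<Phi>1 (?m (F d b))) \<one>\<^bsub>G\<^esub> = F d b \<otimes>\<^bsub>A\<^esub> inv\<^bsub>A\<^esub> F d (s b)"
    if db: "d \<in> D" "b \<in> carrier B" for d b
  proof -
    have eq: "\<Phi>1 (?m (F d b)) = commutator TG.K (?i1 d) (?j1 b)"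
      using db DG by (simp only: mF \<Phi>1.hom_commutator q.L.hom_closed q.R.hom_closed \<Phi>1(2,3))
    show "snd (\<Phi>1 (?m (F d b))) = \<one>\<^bsub>G\<^esub>"
      unfolding eq using db DG by (intro t1(3))
    have "fst (\<Phi>1 (?m (F d b))) \<one>\<^bsub>G\<^esub> = \<beta>1 d b"
      unfolding eq using db DG by (intro t1(4))
    then show "fst (\<Phi>1 (?m (F d b))) \<one>\<^bsub>G\<^esub> = F d b \<otimes>\<^bsub>A\<^esub> inv\<^bsub>A\<^esub> F d (s b)"
      by (simp add: \<beta>1_def lie_retractionD(2)[OF r db(1)])
  qed
  have e2: "snd (\<Phi>2 (?m (F d b))) = \<one>\<^bsub>B\<^esub>"
    "fst (\<Phi>2 (?m (F d b))) \<one>\<^bsub>B\<^esub> = inv\<^bsub>A\<^esub> F d (s b)"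
    if db: "d \<in> D" "b \<in> carrier B" for d b
  proof -
    have K: "?i2 b \<in> carrier TB.K" "?j2 d \<in> carrier TB.K"
      using hom_in_carrier[OF t2(1) db(2)] hom_in_carrier[OF t2(2) DG[OF db(1)]] .
    \<comment> \<open>\<open>[L d, R b]\<close> becomes \<open>[?j2 d, ?i2 b]\<close>, the inverse
      of the commutator treated in \<open>t2\<close>.\<close>
    have eq: "\<Phi>2 (?m (F d b)) = inv\<^bsub>TB.K\<^esub> commutator TB.K (?i2 b) (?j2 d)"
      using db DG
      by (simp only: mF \<Phi>2.hom_commutator q.L.hom_closed q.R.hom_closed \<Phi>2(2,3) TB.K.inv_commutator[OF K])
    note inv = TB.K_inv_base[OF TB.K.commutator_closed[OF K] t2(3)[OF db(2) DG[OF db(1)]]]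
    show "snd (\<Phi>2 (?m (F d b))) = \<one>\<^bsub>B\<^esub>"
      unfolding eq by (rule inv(1))
    show "fst (\<Phi>2 (?m (F d b))) \<one>\<^bsub>B\<^esub> = inv\<^bsub>A\<^esub> F d (s b)"
      unfolding eq inv(2) t2(4)[OF db(2) DG[OF db(1)]]
      by (simp add: \<beta>2_def lie_retractionD(2)[OF r db(1)])
  qed
  let ?C = "p.P\<lparr>carrier := generate p.P S\<rparr>"
  have "(\<lambda>c. fst (\<Phi>1 (?m c)) \<one>\<^bsub>G\<^esub>) \<in> hom ?C A"
    using e1(1) by (intro TG.twisted_eval_hom[OF p.P.group_axioms _ S(1)] hom_compose[OF m(1) \<Phi>1(1), unfolded comp_def])
      (auto simp: S_def)
  moreover have "(\<lambda>c. fst (\<Phi>2 (?m c)) \<one>\<^bsub>B\<^esub>) \<in> hom ?C A"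
    using e2(1) by (intro TB.twisted_eval_hom[OF p.P.group_axioms _ S(1)] hom_compose[OF m(1) \<Phi>2(1), unfolded comp_def])
      (auto simp: S_def)
  \<comment> \<open>The second evaluation already carries an inverse by \<open>e2\<close>, so on a
    generator this quotient is \<open>F d b F d (s b)^-1 F d (s b)\<close>, which is
    \<open>F d b\<close>.\<close>
  ultimately have eval: "(\<lambda>c. fst (\<Phi>1 (?m c)) \<one>\<^bsub>G\<^esub> \<otimes>\<^bsub>A\<^esub> inv\<^bsub>A\<^esub> fst (\<Phi>2 (?m c)) \<one>\<^bsub>B\<^esub>) \<in> hom ?C A"
    by (auto simp: hom_def Pi_iff A.inv_mult A.m_ac)
  have incl: "(\<lambda>c. c) \<in> hom ?C A"
    using p.P.generate_subgroup_incl[OF S(2) p.P.lower_central_2_subgroup] by (auto simp: hom_def A_simps)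
  have recover: "fst (\<Phi>1 (?m c)) \<one>\<^bsub>G\<^esub> \<otimes>\<^bsub>A\<^esub> inv\<^bsub>A\<^esub> fst (\<Phi>2 (?m c)) \<one>\<^bsub>B\<^esub> = c"
    if "c \<in> generate p.P S" for c
  proof (rule p.P.hom_eq_on_generate[OF S(1) A.group_axioms eval incl _ that])
    fix c assume "c \<in> S"
    then obtain d b where db: "d \<in> D" "b \<in> carrier B" "c = F d b" by (auto simp: S_def)
    then show "fst (\<Phi>1 (?m c)) \<one>\<^bsub>G\<^esub> \<otimes>\<^bsub>A\<^esub> inv\<^bsub>A\<^esub> fst (\<Phi>2 (?m c)) \<one>\<^bsub>B\<^esub> = c"
      using s2[OF db(2)] by (simp add: e1 e2 F_closed A.m_assoc)
  qed
  have "V3_coproduct_map G B (\<lambda>x. x) (\<lambda>y. y) \<in> mon p.P q.P"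
  proof (rule V3_coproduct_map_mon[OF D.V3_group_axioms B.V3_group_axioms G.V3_group_axioms B.V3_group_axioms])
    show "(\<lambda>x. x) \<in> mon D' G" "(\<lambda>y. y) \<in> mon B B"
      using id_homs by (simp_all add: mon_def)
    fix c assume c: "c \<in> cartesian_subgroup D' B" "?m c = \<one>\<^bsub>q.P\<^esub>"
    have "\<Phi>1 (?m c) = \<one>\<^bsub>TG.K\<^esub>" "\<Phi>2 (?m c) = \<one>\<^bsub>TB.K\<^esub>"
      unfolding c(2) by (fact \<Phi>1.hom_one \<Phi>2.hom_one)+
    then have "c = \<one>\<^bsub>A\<^esub>" using recover[of c] c(1) by (simp add: C)
    then show "c = \<one>\<^bsub>p.P\<^esub>" by (simp add: A_simps)
  qed
  then show ?thesis by (simp only: D'_def)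
qed

end
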